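(* Let $M$ be a connected Riemannian manifold, regarded as a metric space $(M,d)$ with its Riemannian distance $d$. If $(M,d)$ is homogeneous and admits dilations, then $M$ is isometric to a Euclidean space.
   Context: A metric space $(X,d)$ is homogeneous if its isometry group acts transitively on $X$. A dilation of $(X,d)$ with center $S\in X$ and dilation factor $\lambda>0$ is a map $\delta_\lambda:X\to X$ which fixes $S$ and satisfies $d(\delta_\lambda x,\delta_\lambda y)=\lambda\, d(x,y)$ for all $x,y\in X$. The metric space $X$ admits dilations if for every $\lambda>0$ there is a dilation of $X$ with dilation factor $\lambda$. A Euclidean space is $\mathbb{R}^n$ with its standard flat metric. *)

theory Defs
  imports "HOL-Analysis.Analysis"
begin

section \<open>Smooth manifolds\<close>

text \<open>
  The model space is a type \<open>'e\<close> of class \<^class>\<open>real_inner\<close> that the locale below requires to be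
  finite-dimensional. Class \<^class>\<open>euclidean_space\<close> would exclude zero-dimensional manifolds, since it
  has a nonempty basis.
\<close>

type_synonym ('a, 'e) chart = "'a set \<times> ('a \<Rightarrow> 'e)"

definition is_chart :: "'a topology \<Rightarrow> ('a, 'e::real_inner) chart \<Rightarrow> bool" where
  "is_chart X c \<longleftrightarrow>
     openin X (fst c) \<and> open (snd c ` fst c) \<and>
     homeomorphic_map (subtopology X (fst c)) (top_of_set (snd c ` fst c)) (snd c)"

definition transition :: "('a, 'e) chart \<Rightarrow> ('a, 'e) chart \<Rightarrow> 'e \<Rightarrow> 'e" where
  "transition c c' = snd c' \<circ> inv_into (fst c) (snd c)"

text \<open>
  Class $C^k$ by iterated directional derivatives. It is meant for open \<open>S\<close> and
  finite-dimensional \<open>'e\<close>, where continuity of all the directional derivatives amounts to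
  continuity of the derivative.
\<close>

primrec Ck_on :: "nat \<Rightarrow> 'e set \<Rightarrow> ('e::real_normed_vector \<Rightarrow> 'f::real_normed_vector) \<Rightarrow> bool" where
  "Ck_on 0 S f \<longleftrightarrow> continuous_on S f"
| "Ck_on (Suc k) S f \<longleftrightarrow>
     (\<forall>x\<in>S. f differentiable (at x)) \<and> (\<forall>v. Ck_on k S (\<lambda>x. frechet_derivative f (at x) v))"

definition smooth_on :: "'e set \<Rightarrow> ('e::real_normed_vector \<Rightarrow> 'f::real_normed_vector) \<Rightarrow> bool" where
  "smooth_on S f \<longleftrightarrow> (\<forall>k. Ck_on k S f)"

locale smooth_manifold =
  fixes X :: "'a topology" and A :: "('a, 'e::real_inner) chart set"
  assumes finite_dim: "\<exists>B :: 'e set. finite B \<and> span B = UNIV"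
    and Hausdorff: "Hausdorff_space X"
    and second_countable: "second_countable X"
    and charts: "\<And>c. c \<in> A \<Longrightarrow> is_chart X c"
    and covers: "topspace X = (\<Union>c\<in>A. fst c)"
    and compatible: "\<And>c c'. \<lbrakk>c \<in> A; c' \<in> A\<rbrakk> \<Longrightarrow>
      smooth_on (snd c ` (fst c \<inter> fst c')) (transition c c')"


section \<open>Riemannian manifolds and the Riemannian distance\<close>

text \<open>
  A Riemannian metric is given by its coordinate representations: \<open>g c p v w\<close> is the inner
  product at the point \<open>p\<close> of the tangent vectors whose coordinates in the chart \<open>c\<close> are \<open>v\<close> and
  \<open>w\<close>. Only its values for charts \<open>c\<close> in the atlas and points \<open>p\<close> in the domain of \<open>c\<close> are
  relevant. The assumption \<open>tensor\<close> says that the representations define a tensor field.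
\<close>

locale riemannian_manifold = smooth_manifold X A
  for X :: "'a topology" and A :: "('a, 'e::real_inner) chart set" +
  fixes g :: "('a, 'e) chart \<Rightarrow> 'a \<Rightarrow> 'e \<Rightarrow> 'e \<Rightarrow> real"
  assumes bilinear: "\<And>c p. \<lbrakk>c \<in> A; p \<in> fst c\<rbrakk> \<Longrightarrow> bilinear (g c p)"
    and symmetric: "\<And>c p v w. \<lbrakk>c \<in> A; p \<in> fst c\<rbrakk> \<Longrightarrow> g c p v w = g c p w v"
    and positive: "\<And>c p v. \<lbrakk>c \<in> A; p \<in> fst c; v \<noteq> 0\<rbrakk> \<Longrightarrow> g c p v v > 0"
    and tensor: "\<And>c c' p v w. \<lbrakk>c \<in> A; c' \<in> A; p \<in> fst c \<inter> fst c'\<rbrakk> \<Longrightarrow>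
      g c p v w =
        g c' p (frechet_derivative (transition c c') (at (snd c p)) v)
               (frechet_derivative (transition c c') (at (snd c p)) w)"
    and smooth: "\<And>c v w. c \<in> A \<Longrightarrow>
      smooth_on (snd c ` fst c) (\<lambda>x. g c (inv_into (fst c) (snd c) x) v w)"

text \<open>
  Being $C^1$ on \<open>{a..b}\<close> includes the existence of one-sided derivatives at \<open>a\<close> and \<open>b\<close>, with
  respect to which the velocity is continuous up to the endpoints.
\<close>

definition C1_path_on :: "('a, 'e::real_inner) chart set \<Rightarrow> real \<Rightarrow> real \<Rightarrow> (real \<Rightarrow> 'a) \<Rightarrow> bool" where
  "C1_path_on A a b \<gamma> \<longleftrightarrow>
     (\<forall>c\<in>A. let J = {t \<in> {a..b}. \<gamma> t \<in> fst c} in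
        \<exists>v. continuous_on J v \<and>
            (\<forall>t\<in>J. (snd c \<circ> \<gamma> has_vector_derivative v t) (at t within J)))"

text \<open>The finite set \<open>T\<close> contains the break points.\<close>

definition piecewise_C1_path ::
    "'a topology \<Rightarrow> ('a, 'e::real_inner) chart set \<Rightarrow> (real \<Rightarrow> 'a) \<Rightarrow> bool" where
  "piecewise_C1_path X A \<gamma> \<longleftrightarrow>
     pathin X \<gamma> \<and>
     (\<exists>T. finite T \<and>
        (\<forall>a b. 0 \<le> a \<and> a < b \<and> b \<le> 1 \<and> {a<..<b} \<inter> T = {} \<longrightarrow> C1_path_on A a b \<gamma>))"

text \<open>
  On a Riemannian manifold the speed does not depend on which chart around \<open>\<gamma> t\<close> is chosen,
  provided that \<open>\<gamma>\<close> is differentiable at \<open>t\<close>. The values at the break points do not affect the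
  length.
\<close>

definition path_speed ::
    "('a, 'e::real_inner) chart set \<Rightarrow> (('a, 'e) chart \<Rightarrow> 'a \<Rightarrow> 'e \<Rightarrow> 'e \<Rightarrow> real) \<Rightarrow>
     (real \<Rightarrow> 'a) \<Rightarrow> real \<Rightarrow> real" where
  "path_speed A g \<gamma> t =
     (let c = (SOME c. c \<in> A \<and> \<gamma> t \<in> fst c);
          v = vector_derivative (snd c \<circ> \<gamma>) (at t within {0..1})
      in sqrt (g c (\<gamma> t) v v))"

definition path_length ::
    "('a, 'e::real_inner) chart set \<Rightarrow> (('a, 'e) chart \<Rightarrow> 'a \<Rightarrow> 'e \<Rightarrow> 'e \<Rightarrow> real) \<Rightarrow>
     (real \<Rightarrow> 'a) \<Rightarrow> real" where
  "path_length A g \<gamma> = integral {0..1} (path_speed A g \<gamma>)"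

text \<open>The infimum is over a nonempty set whenever \<open>X\<close> is connected.\<close>

definition riemannian_dist ::
    "'a topology \<Rightarrow> ('a, 'e::real_inner) chart set \<Rightarrow>
     (('a, 'e) chart \<Rightarrow> 'a \<Rightarrow> 'e \<Rightarrow> 'e \<Rightarrow> real) \<Rightarrow> 'a \<Rightarrow> 'a \<Rightarrow> real" where
  "riemannian_dist X A g x y =
     Inf {path_length A g \<gamma> | \<gamma>. piecewise_C1_path X A \<gamma> \<and> \<gamma> 0 = x \<and> \<gamma> 1 = y}"


section \<open>Isometries and dilations\<close>

definition isometry_onto ::
    "'a set \<Rightarrow> ('a \<Rightarrow> 'a \<Rightarrow> real) \<Rightarrow> 'b set \<Rightarrow> ('b \<Rightarrow> 'b \<Rightarrow> real) \<Rightarrow> ('a \<Rightarrow> 'b) \<Rightarrow> bool" where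
  "isometry_onto M d N d' f \<longleftrightarrow>
     bij_betw f M N \<and> (\<forall>x\<in>M. \<forall>y\<in>M. d' (f x) (f y) = d x y)"

definition isometric ::
    "'a set \<Rightarrow> ('a \<Rightarrow> 'a \<Rightarrow> real) \<Rightarrow> 'b set \<Rightarrow> ('b \<Rightarrow> 'b \<Rightarrow> real) \<Rightarrow> bool" where
  "isometric M d N d' \<longleftrightarrow> (\<exists>f. isometry_onto M d N d' f)"

definition homogeneous :: "'a set \<Rightarrow> ('a \<Rightarrow> 'a \<Rightarrow> real) \<Rightarrow> bool" where
  "homogeneous M d \<longleftrightarrow> (\<forall>x\<in>M. \<forall>y\<in>M. \<exists>f. isometry_onto M d M d f \<and> f x = y)"

definition is_dilation ::
    "'a set \<Rightarrow> ('a \<Rightarrow> 'a \<Rightarrow> real) \<Rightarrow> 'a \<Rightarrow> real \<Rightarrow> ('a \<Rightarrow> 'a) \<Rightarrow> bool" where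
  "is_dilation M d S \<mu> \<delta> \<longleftrightarrow>
     S \<in> M \<and> \<mu> > 0 \<and> \<delta> \<in> M \<rightarrow> M \<and> \<delta> S = S \<and>
     (\<forall>x\<in>M. \<forall>y\<in>M. d (\<delta> x) (\<delta> y) = \<mu> * d x y)"

definition admits_dilations :: "'a set \<Rightarrow> ('a \<Rightarrow> 'a \<Rightarrow> real) \<Rightarrow> bool" where
  "admits_dilations M d \<longleftrightarrow> (\<forall>\<mu>>0. \<exists>S \<delta>. is_dilation M d S \<mu> \<delta>)"

text \<open>The standard metric of $\mathbf{R}^n$, realised as \<^term>\<open>topspace (Euclidean_space n)\<close>.\<close>

definition euclidean_dist :: "nat \<Rightarrow> (nat \<Rightarrow> real) \<Rightarrow> (nat \<Rightarrow> real) \<Rightarrow> real" where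
  "euclidean_dist n x y = L2_set (\<lambda>i. x i - y i) {..<n}"

end

theory Submission
  imports Defs
begin

text \<open>
  Near a point \<open>p\<close>, a chart that is linearly normalised at \<open>p\<close> distorts the Riemannian distance by
  factors tending to 1. By homogeneity there are dilations centred at \<open>p\<close>. Contracting by \<open>1 / n\<close>,
  applying the chart and rescaling by \<open>n\<close> gives maps from \<open>M\<close> to the tangent space at \<open>p\<close> that are
  asymptotically isometric on any two points; a cluster point \<open>f\<close> is an isometric embedding. Composing
  \<open>f\<close> with dilations by \<open>n\<close> of the rescaled inverse chart gives, in the limit, an isometric self-map of
  the tangent space with values in the closure of the image of \<open>f\<close>. Such a map is orthogonal up to
  translation, hence surjective, so the image of \<open>f\<close> is dense. It is closed because homogeneity makes
  \<open>M\<close> uniformly locally compact.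
\<close>

section \<open>Positive definite forms in finite dimension\<close>

text \<open>\<open>riemannian_dist\<close> is an infimum about which nothing is known beforehand,
  not even that distinct points have positive distance, and the competing paths may leave the chart.
  All Riemannian input is therefore condensed into one local statement,
  \<open>param_almost_isometric\<close>: for every tolerance a two-sided comparison with the flat
  distance, plus the fact that points at small distance from \<open>p\<close> lie in the chart. Its
  lower half rests on a margin: leaving a chart ball of radius \<open>3 * r\<close> costs more than
  joining two points of the concentric ball of radius \<open>r\<close>. The dilations are arbitrary
  maps, one for each factor, and nothing relates those of different factors. Each is used only for
  what it does to distances, and a limit has to come from compactness instead of from a
  one-parameter group. Density of the image improves to surjectivity because the radius of the
  compact neighbourhoods does not depend on the point: a point of the image can be chosen within
  that radius of any given vector. Finite dimension is a hypothesis on a \<open>real_inner\<close>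
  type, so compactness of balls and boundedness of linear maps are derived from a finite orthonormal
  basis, possibly empty.\<close>

locale inner_form =
  fixes \<beta> :: "'e::real_vector \<Rightarrow> 'e \<Rightarrow> real"
  assumes bilin: "bilinear \<beta>"
    and sym: "\<beta> v w = \<beta> w v"
    and pos: "v \<noteq> 0 \<Longrightarrow> \<beta> v v > 0"

definition orthonormal_basis :: "('e::real_vector \<Rightarrow> 'e \<Rightarrow> real) \<Rightarrow> 'e set \<Rightarrow> bool" where
  "orthonormal_basis \<beta> B \<longleftrightarrow>
     finite B \<and> span B = UNIV \<and> (\<forall>x\<in>B. \<forall>y\<in>B. \<beta> x y = (if x = y then 1 else 0))"

context inner_form
begin

lemma linear_left: "linear (\<lambda>v. \<beta> v w)" and linear_right: "linear (\<beta> v)"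
  using bilin by (auto simp: bilinear_def)

lemmas form_simps =
  linear_add[OF linear_left] linear_add[OF linear_right]
  linear_diff[OF linear_left] linear_diff[OF linear_right]
  linear_cmul[OF linear_left] linear_cmul[OF linear_right]
  linear_sum[OF linear_left] linear_sum[OF linear_right]
  linear_0[OF linear_left] linear_0[OF linear_right]

text \<open>Gram-Schmidt by induction on the spanning set. A vector that already lies in the span of
  its predecessors leaves residue 0 and is dropped, so \<open>B\<close> may be dependent.\<close>

lemma orthonormal_extend:
  assumes "finite B"
  shows "\<exists>C. finite C \<and> span C = span B \<and> (\<forall>x\<in>C. \<forall>y\<in>C. \<beta> x y = (if x = y then 1 else 0))"
  using assms
proof (induction B rule: finite_induct)
  case empty
  then show ?case by (intro exI[of _ "{}"]) auto
next
  case (insert a B)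
  then obtain C where C: "finite C" "span C = span B"
    and on: "\<And>x y. x \<in> C \<Longrightarrow> y \<in> C \<Longrightarrow> \<beta> x y = (if x = y then 1 else 0)" by blast
  \<comment> \<open>The residue of \<open>a\<close> after subtracting its \<beta>-orthogonal
    projection onto the span of \<open>C\<close>.\<close>
  define u where "u = a - (\<Sum>c\<in>C. \<beta> a c *\<^sub>R c)"
  have sumC: "(\<Sum>c\<in>C. \<beta> a c *\<^sub>R c) \<in> span C"
    by (intro span_sum span_scale span_base)
  have ou: "\<beta> u c = 0" if "c \<in> C" for c
  proof -
    have "\<beta> u c = \<beta> a c - (\<Sum>x\<in>C. \<beta> a x * \<beta> x c)"
      by (simp add: u_def form_simps)
    also have "(\<Sum>x\<in>C. \<beta> a x * \<beta> x c) = (\<Sum>x\<in>C. if x = c then \<beta> a x else 0)"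
      using on that by (intro sum.cong) auto
    finally show ?thesis using C that by simp
  qed
  have spanu: "span (insert a B) = span (insert u C)"
  proof -
    have "a \<in> span (insert u C)"
    proof -
      have "a = u + (\<Sum>c\<in>C. \<beta> a c *\<^sub>R c)" by (simp add: u_def)
      moreover have "u \<in> span (insert u C)" by (simp add: span_base)
      moreover have "(\<Sum>c\<in>C. \<beta> a c *\<^sub>R c) \<in> span (insert u C)"
        using sumC span_mono[of C "insert u C"] by auto
      ultimately show ?thesis using span_add by metis
    qed
    moreover have "u \<in> span (insert a B)"
      unfolding u_def using sumC C span_mono[of B "insert a B"]
      by (intro span_diff) (auto simp: span_base)
    moreover have "B \<subseteq> span (insert u C)"
      using C span_mono[of C "insert u C"] span_superset[of B] by auto
    moreover have "C \<subseteq> span (insert a B)"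
      using C span_mono[of B "insert a B"] span_superset[of C] by auto
    ultimately show ?thesis by (auto simp: span_eq)
  qed
  show ?case
  proof (cases "u = 0")
    case True
    then have "span (insert a B) = span C"
      using spanu by simp
    then show ?thesis using C on by (intro exI[of _ C]) auto
  next
    case False
    define n where "n = sqrt (\<beta> u u)"
    have n: "n > 0" "\<beta> u u = n * n" using pos[OF False] by (auto simp: n_def)
    define e where "e = (1/n) *\<^sub>R u"
    have "\<beta> e e = 1" using n by (simp add: e_def form_simps)
    moreover have ec: "\<beta> e c = 0" "\<beta> c e = 0" if "c \<in> C" for c
      using ou[OF that] sym[of c u] by (simp_all add: e_def form_simps)
    moreover have "e \<notin> C" using ec calculation(1) by force
    moreover have spane: "span (insert e C) = span (insert u C)"
    proof -
      have "u = n *\<^sub>R e" using n by (simp add: e_def)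
      then have "u \<in> span (insert e C)" by (simp add: span_base span_scale)
      moreover have "e \<in> span (insert u C)"
        unfolding e_def by (simp add: span_base span_scale)
      moreover have "C \<subseteq> span (insert e C)" "C \<subseteq> span (insert u C)"
        using span_superset[of "insert e C"] span_superset[of "insert u C"] by auto
      ultimately show ?thesis by (auto simp: span_eq)
    qed
    ultimately have "\<forall>x\<in>insert e C. \<forall>y\<in>insert e C. \<beta> x y = (if x = y then 1 else 0)"
      using on by (metis insert_iff)
    moreover have "span (insert e C) = span (insert a B)"
      using spane spanu by simp
    ultimately show ?thesis using C(1) by blast
  qed
qed

lemma orthonormal_basis_exists:
  assumes "finite (B :: 'e set)" "span B = UNIV"
  obtains C where "orthonormal_basis \<beta> C"
  using orthonormal_extend[OF assms(1)] assms(2) that by (auto simp: orthonormal_basis_def)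

lemma orthonormal_coeff:
  assumes "orthonormal_basis \<beta> B" "b \<in> B"
  shows "\<beta> (\<Sum>c\<in>B. k c *\<^sub>R c) b = k b"
proof -
  have "\<beta> (\<Sum>c\<in>B. k c *\<^sub>R c) b = (\<Sum>c\<in>B. k c * \<beta> c b)"
    by (simp add: form_simps)
  also have "\<dots> = (\<Sum>c\<in>B. if c = b then k c else 0)"
    using assms by (intro sum.cong) (auto simp: orthonormal_basis_def)
  finally show ?thesis using assms by (simp add: orthonormal_basis_def)
qed

lemma orthonormal_expansion:
  assumes "orthonormal_basis \<beta> B"
  shows "(\<Sum>b\<in>B. \<beta> v b *\<^sub>R b) = v"
proof -
  have fin: "finite B" "v \<in> span B" using assms by (auto simp: orthonormal_basis_def)
  obtain k where k: "v = (\<Sum>b\<in>B. k b *\<^sub>R b)"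
    using fin by (auto simp: span_finite)
  then show ?thesis using orthonormal_coeff[OF assms] by simp
qed

lemma orthonormal_form:
  assumes "orthonormal_basis \<beta> B"
  shows "\<beta> v w = (\<Sum>b\<in>B. \<beta> v b * \<beta> w b)"
proof -
  have "\<beta> v w = \<beta> v (\<Sum>b\<in>B. \<beta> w b *\<^sub>R b)" using orthonormal_expansion[OF assms] by simp
  also have "\<dots> = (\<Sum>b\<in>B. \<beta> v b * \<beta> w b)"
    by (simp add: form_simps mult.commute)
  finally show ?thesis .
qed

lemma orthonormal_independent:
  assumes "orthonormal_basis \<beta> B"
  shows "independent B"
proof -
  have fin: "finite B" using assms by (auto simp: orthonormal_basis_def)
  show ?thesis
    unfolding independent_explicit_finite_subsets
  proof (intro allI impI ballI)
    fix A u a assume A: "A \<subseteq> B" "finite A" "(\<Sum>a\<in>A. u a *\<^sub>R a) = 0" "a \<in> A"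
    define k where "k x = (if x \<in> A then u x else 0)" for x
    have "(\<Sum>c\<in>B. k c *\<^sub>R c) = (\<Sum>c\<in>A. u c *\<^sub>R c)"
      using A fin by (intro sum.mono_neutral_cong_right) (auto simp: k_def)
    then have "k a = 0"
      using orthonormal_coeff[OF assms, of a k] A by (auto simp: form_simps)
    then show "u a = 0" using A by (simp add: k_def)
  qed
qed

end

section \<open>Finite-dimensional inner product spaces\<close>

interpretation dot: inner_form "inner :: 'e::real_inner \<Rightarrow> 'e \<Rightarrow> real"
  by unfold_locales (auto simp: bilinear_def inner_add inner_commute
      intro!: linearI)

lemma orthonormal_basis_inner_exists:
  assumes "\<exists>B :: 'e::real_inner set. finite B \<and> span B = UNIV"
  obtains C :: "'e::real_inner set" where "orthonormal_basis inner C"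
  using dot.orthonormal_basis_exists assms by blast

lemma norm_orthonormal_le:
  fixes B :: "'e::real_inner set"
  assumes "orthonormal_basis inner B" "b \<in> B"
  shows "\<bar>v \<bullet> b\<bar> \<le> norm v"
proof -
  have "norm b = 1" using assms by (simp add: orthonormal_basis_def norm_eq_sqrt_inner)
  then show ?thesis using Cauchy_Schwarz_ineq2[of v b] by simp
qed

text \<open>Expand the argument in a finite orthonormal basis; each coefficient is bounded by the
  norm.\<close>

lemma bounded_linear_finite_dim:
  fixes f :: "'e::real_inner \<Rightarrow> 'f::real_normed_vector"
  assumes fd: "\<exists>B :: 'e set. finite B \<and> span B = UNIV" and "linear f"
  shows "bounded_linear f"
proof -
  obtain B :: "'e set" where B: "orthonormal_basis inner B"
    using orthonormal_basis_inner_exists fd by blast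
  show ?thesis
  proof (intro bounded_linear_intro[where K = "\<Sum>b\<in>B. norm (f b)"])
    fix x
    have "f x = (\<Sum>b\<in>B. (x \<bullet> b) *\<^sub>R f b)"
      by (subst dot.orthonormal_expansion[OF B, of x, symmetric])
        (simp add: linear_sum[OF assms(2)] linear_cmul[OF assms(2)])
    also have "norm \<dots> \<le> (\<Sum>b\<in>B. norm x * norm (f b))"
      using norm_orthonormal_le[OF B] by (intro sum_norm_le) (auto intro!: mult_right_mono)
    finally show "norm (f x) \<le> norm x * (\<Sum>b\<in>B. norm (f b))"
      by (simp add: sum_distrib_left)
  qed (use assms(2) in \<open>auto simp: linear_add linear_cmul\<close>)
qed

text \<open>The ball is a closed subset of a continuous image of a cube, and the cube is compact by
  Tychonoff.\<close>

lemma compact_cball_finite_dim: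
  fixes x :: "'e::real_inner"
  assumes fd: "\<exists>B :: 'e set. finite B \<and> span B = UNIV"
  shows "compact (cball x r)"
proof -
  obtain B :: "'e set" where B: "orthonormal_basis inner B"
    using orthonormal_basis_inner_exists fd by blast
  have fin: "finite B" using B by (simp add: orthonormal_basis_def)
  \<comment> \<open>The product runs over the whole type and not over \<open>B\<close>, so that its
    topology is that of the function type; only the coordinates in \<open>B\<close> enter
    \<open>s\<close>.\<close>
  define K where "K = (\<Pi>\<^sub>E b\<in>(UNIV :: 'e set). {-r..r})"
  have "compactin (product_topology (\<lambda>_. euclidean) UNIV) K"
    unfolding K_def by (subst compactin_PiE) auto
  then have K: "compact K" by (simp add: euclidean_product_topology)
  define s where "s k = x + (\<Sum>b\<in>B. k b *\<^sub>R b)" for k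
  have "continuous_on K s"
    unfolding s_def
    by (intro continuous_intros continuous_on_subset[OF continuous_on_product_coordinates] subset_UNIV)
  then have "compact (s ` K)" using K by (rule compact_continuous_image)
  moreover have "cball x r \<subseteq> s ` K"
  proof
    fix y assume y: "y \<in> cball x r"
    define k where "k b = (if b \<in> B then (y - x) \<bullet> b else 0)" for b
    have "r \<ge> 0" using y by (smt (verit) mem_cball zero_le_dist)
    then have "k \<in> K"
      using norm_orthonormal_le[OF B, of _ "y - x"] y
      by (fastforce simp: K_def k_def dist_norm norm_minus_commute abs_le_iff)
    moreover have "s k = y"
      using dot.orthonormal_expansion[OF B, of "y - x"]
      by (simp add: s_def k_def)
    ultimately show "y \<in> s ` K" by auto
  qed
  ultimately show ?thesis
    using compact_Int_closed[of "s ` K" "cball x r"] by (simp add: Int_absorb1)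
qed

text \<open>\<open>L\<close> sends a \<beta>-orthonormal basis to an
  \<open>inner\<close>-orthonormal one. Both are bases of the same space and hence have equally many
  elements.\<close>

lemma inner_form_linear_isometry:
  fixes \<beta> :: "'e::real_inner \<Rightarrow> 'e \<Rightarrow> real"
  assumes "inner_form \<beta>" and fd: "\<exists>B :: 'e set. finite B \<and> span B = UNIV"
  obtains L L' :: "'e \<Rightarrow> 'e" where "linear L" "linear L'" "\<And>v. L' (L v) = v" "\<And>v. L (L' v) = v"
    "\<And>v w. \<beta> v w = L v \<bullet> L w"
proof -
  interpret inner_form \<beta> by fact
  obtain B where B: "orthonormal_basis \<beta> B"
    using orthonormal_basis_exists fd by blast
  obtain C :: "'e set" where C: "orthonormal_basis inner C"
    using orthonormal_basis_inner_exists fd by blast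
  have fin: "finite B" "finite C" using B C by (auto simp: orthonormal_basis_def)
  have "card B = card C"
    using real_vector.dim_eq_card[of B UNIV] real_vector.dim_eq_card[of C UNIV] B C
      orthonormal_independent[OF B] dot.orthonormal_independent[OF C]
    by (auto simp: orthonormal_basis_def)
  then obtain h where h: "bij_betw h B C"
    using fin finite_same_card_bij by blast
  define L where "L v = (\<Sum>b\<in>B. \<beta> v b *\<^sub>R h b)" for v
  define L' where "L' v = (\<Sum>b\<in>B. (v \<bullet> h b) *\<^sub>R b)" for v
  have inj: "inj_on h B" "h ` B = C" using h by (auto simp: bij_betw_def)
  have Lh: "L v \<bullet> h b = \<beta> v b" if "b \<in> B" for v b
  proof -
    have "L v = (\<Sum>c\<in>C. \<beta> v (inv_into B h c) *\<^sub>R c)"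
      unfolding L_def inj(2)[symmetric] by (subst sum.reindex[OF inj(1)]) (simp add: inj)
    then show ?thesis
      using dot.orthonormal_coeff[OF C, of "h b"] inj that by auto
  qed
  have Lh': "\<beta> (L' v) b = v \<bullet> h b" if "b \<in> B" for v b
    using orthonormal_coeff[OF B that] by (simp add: L'_def)
  show thesis
  proof
    show "linear L" unfolding L_def
      by (auto intro!: linearI simp: form_simps algebra_simps sum.distrib scaleR_sum_right)
    show "linear L'" unfolding L'_def
      by (auto intro!: linearI simp: inner_add algebra_simps sum.distrib scaleR_sum_right)
    show "L' (L v) = v" for v
      using orthonormal_expansion[OF B, of v] by (simp add: L'_def Lh)
    have exC: "(\<Sum>b\<in>B. (v \<bullet> h b) *\<^sub>R h b) = v" for v
      using dot.orthonormal_expansion[OF C, of v]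
      by (simp add: inj(2)[symmetric] sum.reindex[OF inj(1)])
    show "L (L' v) = v" for v
      using exC[of v] by (simp add: L_def Lh')
    show "\<beta> v w = L v \<bullet> L w" for v w
    proof -
      have "L v \<bullet> L w = L v \<bullet> (\<Sum>b\<in>B. \<beta> w b *\<^sub>R h b)" by (simp add: L_def)
      also have "\<dots> = (\<Sum>b\<in>B. \<beta> v b * \<beta> w b)"
        by (simp add: inner_sum_right Lh mult.commute)
      finally show ?thesis using orthonormal_form[OF B, of v w] by metis
    qed
  qed
qed

text \<open>The isometry takes coordinates in an orthonormal basis of \<open>n\<close> elements.
  Points of \<open>Euclidean_space n\<close> are sequences vanishing from index \<open>n\<close> on,
  hence the value 0 there.\<close>

lemma isometric_Euclidean_space:
  assumes fd: "\<exists>B :: 'e::real_inner set. finite B \<and> span B = UNIV"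
  shows "\<exists>n. isometric (UNIV :: 'e::real_inner set) dist (topspace (Euclidean_space n)) (euclidean_dist n)"
proof -
  obtain B :: "'e set" where B: "orthonormal_basis inner B"
    using orthonormal_basis_inner_exists fd by blast
  have fin: "finite B" using B by (simp add: orthonormal_basis_def)
  then obtain b where b: "bij_betw b {..<card B} B"
    using finite_same_card_bij[of "{..<card B}" B] by auto
  define n where "n = card B"
  note b = b[folded n_def]
  define f where "f v i = (if i < n then v \<bullet> b i else 0)" for v i
  define f' where "f' x = (\<Sum>i<n. x i *\<^sub>R b i)" for x :: "nat \<Rightarrow> real"
  have bij: "inj_on b {..<n}" "b ` {..<n} = B" using b by (auto simp: bij_betw_def)
  have ff: "f' (f v) = v" for v
    using dot.orthonormal_expansion[OF B, of v]
    by (simp add: f'_def f_def bij(2)[symmetric] sum.reindex[OF bij(1)])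
  have on: "b i \<bullet> b j = (if i = j then 1 else 0)" if "i < n" "j < n" for i j
  proof -
    have "b i \<in> B" "b j \<in> B" using bij that by auto
    then show ?thesis using B bij that by (auto simp: orthonormal_basis_def inj_on_def)
  qed
  have ff': "f (f' x) = x" if "x \<in> topspace (Euclidean_space n)" for x
  proof
    fix i
    show "f (f' x) i = x i"
    proof (cases "i < n")
      case True
      have "f (f' x) i = (\<Sum>j<n. x j * (b j \<bullet> b i))"
        using True by (simp add: f_def f'_def inner_sum_left)
      also have "\<dots> = (\<Sum>j<n. if j = i then x j else 0)"
        using True on by (intro sum.cong) auto
      finally show ?thesis using True by simp
    next
      case False
      then show ?thesis using that by (auto simp: f_def topspace_Euclidean_space)
    qed
  qed
  have "bij_betw f UNIV (topspace (Euclidean_space n))"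
    using ff ff' by (intro bij_betwI[where g = f']) (auto simp: f_def topspace_Euclidean_space)
  moreover have "euclidean_dist n (f v) (f w) = dist v w" for v w
  proof -
    have "dist v w = sqrt (\<Sum>c\<in>B. ((v - w) \<bullet> c) * ((v - w) \<bullet> c))"
      using dot.orthonormal_form[OF B, of "v - w" "v - w"]
      by (simp add: dist_norm norm_eq_sqrt_inner)
    also have "\<dots> = sqrt (\<Sum>i<n. (f v i - f w i)\<^sup>2)"
      by (simp add: bij(2)[symmetric] sum.reindex[OF bij(1)] f_def inner_diff_left power2_eq_square)
    finally show ?thesis by (simp add: euclidean_dist_def L2_set_def)
  qed
  ultimately show ?thesis unfolding isometric_def isometry_onto_def by blast
qed


section \<open>Limits of almost isometric maps\<close>

text \<open>Tychonoff's theorem replaces a diagonal sequence, so no countable dense subset of \<open>'a\<close> is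
  needed; \<open>G\<close> plays the role of a subsequence.\<close>

lemma pointwise_cluster_point:
  fixes F :: "nat \<Rightarrow> 'a \<Rightarrow> 'e::real_inner"
  assumes fd: "\<exists>B :: 'e set. finite B \<and> span B = UNIV"
    and bd: "\<And>n x. norm (F n x) \<le> R x"
  obtains f G where "G \<noteq> bot" "G \<le> sequentially" "\<And>x. ((\<lambda>n. F n x) \<longlongrightarrow> f x) G"
proof -
  define K where "K = (\<Pi>\<^sub>E x\<in>(UNIV :: 'a set). cball (0::'e) (R x))"
  have "compactin (product_topology (\<lambda>_. euclidean) UNIV) K"
    unfolding K_def using compact_cball_finite_dim[OF fd] by (subst compactin_PiE) auto
  then have K: "compact K" by (simp add: euclidean_product_topology)
  have "eventually (\<lambda>f. f \<in> K) (filtermap F sequentially)"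
    using bd by (auto simp: eventually_filtermap K_def intro!: always_eventually)
  then obtain f where f: "inf (nhds f) (filtermap F sequentially) \<noteq> bot"
    using K unfolding compact_filter
    by (metis filtermap_bot_iff trivial_limit_sequentially)
  \<comment> \<open>The coarsest refinement of \<open>sequentially\<close> along which
    \<open>F\<close> converges to \<open>f\<close>. It is proper because \<open>f\<close> is a
    cluster point of \<open>F\<close>.\<close>
  define G where "G = inf (filtercomap F (nhds f)) sequentially"
  have "G \<noteq> bot"
  proof
    assume "G = bot"
    then have "eventually (\<lambda>_. False) G" by simp
    then obtain P Q where PQ: "eventually P (filtercomap F (nhds f))" "eventually Q sequentially"
      "\<And>n. P n \<Longrightarrow> Q n \<Longrightarrow> False"
      unfolding G_def eventually_inf by auto
    obtain P' where P': "eventually P' (nhds f)" "\<And>n. P' (F n) \<Longrightarrow> P n"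
      using PQ(1) by (auto simp: eventually_filtercomap)
    have "eventually (\<lambda>h. \<not> P' h) (filtermap F sequentially)"
      using PQ(2) by (auto simp: eventually_filtermap elim!: eventually_mono dest: P'(2) PQ(3))
    then have "eventually (\<lambda>_. False) (inf (nhds f) (filtermap F sequentially))"
      using P'(1) by (auto simp: eventually_inf)
    then show False using f by (simp add: trivial_limit_def)
  qed
  moreover have "G \<le> sequentially" by (simp add: G_def)
  moreover have "((\<lambda>n. F n x) \<longlongrightarrow> f x) G" for x
  proof -
    have "filterlim F (nhds f) G"
      unfolding G_def by (rule filterlim_mono[OF filterlim_filtercomap order_refl inf_le1])
    moreover have "((\<lambda>h. h x) \<longlongrightarrow> f x) (nhds f)"
      using continuous_on_product_coordinates[of x]
      by (metis UNIV_I continuous_on_def tendsto_at_iff_tendsto_nhds)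
    ultimately show ?thesis by (rule filterlim_compose[rotated])
  qed
  ultimately show thesis by (rule that)
qed

text \<open>Distances to the base point \<open>p\<close>, which every \<open>F n\<close> sends to 0,
  converge and so are bounded. This confines each \<open>F n x\<close> to a ball and makes a
  pointwise cluster point available; the limits of distances pass to it.\<close>

lemma isometric_cluster_point:
  fixes F :: "nat \<Rightarrow> 'a \<Rightarrow> 'e::real_inner"
  assumes fd: "\<exists>B :: 'e set. finite B \<and> span B = UNIV"
    and lim: "\<And>x y. x \<in> M \<Longrightarrow> y \<in> M \<Longrightarrow> (\<lambda>n. dist (F n x) (F n y)) \<longlonglongrightarrow> d x y"
    and p: "p \<in> M" "\<And>n. F n p = 0"
  shows "\<exists>f. f p = 0 \<and> (\<forall>x\<in>M. \<forall>y\<in>M. dist (f x) (f y) = d x y) \<and>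
    (\<forall>x\<in>M. f x \<in> closure (range (\<lambda>n. F n x)))"
proof -
  have "\<exists>R. \<forall>n. norm (F n x) \<le> R" if "x \<in> M" for x
  proof -
    have "(\<lambda>n. dist (F n x) (F n p)) \<longlonglongrightarrow> d x p" using lim that p by blast
    then have "Bseq (\<lambda>n. norm (F n x))" 
      using p by (auto simp: dist_norm intro!: convergent_imp_Bseq convergentI)
    then show ?thesis by (auto simp: Bseq_def)
  qed
  then obtain R where R: "\<And>x n. x \<in> M \<Longrightarrow> norm (F n x) \<le> R x" by metis
  \<comment> \<open>The bound is known on \<open>M\<close> only; extending the maps by 0 makes it
    hold for every argument.\<close>
  then have bd: "norm (if x \<in> M then F n x else 0) \<le> (if x \<in> M then R x else 0)" for n x
    by simp
  obtain f G where G: "G \<noteq> bot" "G \<le> sequentially"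
    and f: "\<And>x. ((\<lambda>n. if x \<in> M then F n x else 0) \<longlongrightarrow> f x) G"
    by (rule pointwise_cluster_point[OF fd, where F = "\<lambda>n x. if x \<in> M then F n x else 0"
          and R = "\<lambda>x. if x \<in> M then R x else 0"]) (use bd in blast)+
  have fM: "((\<lambda>n. F n x) \<longlongrightarrow> f x) G" if "x \<in> M" for x using f[of x] that by simp
  show ?thesis
  proof (intro exI conjI ballI)
    show "f p = 0" using fM[OF p(1)] p(2) G(1) by (simp add: tendsto_const_iff)
    show "dist (f x) (f y) = d x y" if "x \<in> M" "y \<in> M" for x y
      using tendsto_unique[OF G(1) tendsto_dist[OF fM fM] tendsto_mono[OF G(2) lim]] that by blast
    show "f x \<in> closure (range (\<lambda>n. F n x))" if "x \<in> M" for x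
      by (rule Lim_in_closed_set[OF closed_closure _ G(1) fM[OF that]])
        (auto intro!: always_eventually closure_subset[THEN subsetD])
  qed
qed

text \<open>The error is relative to \<open>D n\<close> and not to the limit, so \<open>D n\<close>
  has to be bounded: a tolerance of at most \<open>1/2\<close> gives \<open>D n \<le> 2 * d\<close>,
  which makes the error at most \<open>\<epsilon> * (2 * d)\<close>.\<close>

lemma tendsto_almost:
  fixes D :: "nat \<Rightarrow> real"
  assumes ev: "\<And>\<epsilon>. 0 < \<epsilon> \<Longrightarrow> \<epsilon> < 1 \<Longrightarrow>
      eventually (\<lambda>n. (1 - \<epsilon>) * D n \<le> d \<and> d \<le> (1 + \<epsilon>) * D n) sequentially"
    and nonneg: "\<And>n. D n \<ge> 0"
  shows "D \<longlonglongrightarrow> d"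
proof (rule tendstoI)
  fix e :: real assume e: "e > 0"
  obtain n0 where "(1 - 1/2) * D n0 \<le> d"
    using ev[of "1/2"] by (auto dest: eventually_happens'[OF sequentially_bot])
  then have d: "d \<ge> 0" using nonneg[of n0] by simp
  \<comment> \<open>The summand \<open>1\<close> keeps the denominator positive when
    \<open>d = 0\<close>.\<close>
  define \<epsilon> where "\<epsilon> = min (1/2) (e / (2 * d + 1) / 2)"
  have \<epsilon>: "0 < \<epsilon>" "\<epsilon> \<le> 1/2" "\<epsilon> \<le> e / (2 * d + 1) / 2" using e d unfolding \<epsilon>_def by (simp_all del: min_less_iff_conj add: min_def)
  have "\<epsilon> * (2 * d + 1) \<le> e / 2" using \<epsilon>(3) d by (simp add: field_simps)
  then have small: "\<epsilon> * (2 * d) < e" using \<epsilon>(1) e by (simp add: algebra_simps)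
  show "eventually (\<lambda>n. dist (D n) d < e) sequentially"
  proof (rule eventually_mono[OF ev[of \<epsilon>]])
    fix n assume n: "(1 - \<epsilon>) * D n \<le> d \<and> d \<le> (1 + \<epsilon>) * D n"
    have "(1/2) * D n \<le> (1 - \<epsilon>) * D n"
      using \<epsilon> nonneg[of n] by (intro mult_right_mono) auto
    then have "D n \<le> 2 * d" using n by linarith
    then have "\<epsilon> * D n \<le> \<epsilon> * (2 * d)" using \<epsilon> by (intro mult_left_mono) auto
    then have "\<bar>D n - d\<bar> < e" using n small by (auto simp: algebra_simps abs_less_iff)
    then show "dist (D n) d < e" by (simp add: dist_real_def)
  qed (use \<epsilon> in auto)
qed

text \<open>An isometry fixing 0 preserves inner products and is therefore linear; an injective
  linear endomorphism of a finite-dimensional space is onto. The orthonormal basis \<open>B\<close>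
  serves to interpret the locale containing that fact.\<close>

lemma isometry_finite_dim_surj:
  fixes h :: "'e::real_inner \<Rightarrow> 'e"
  assumes fd: "\<exists>B :: 'e set. finite B \<and> span B = UNIV"
    and h: "h 0 = 0" "\<And>x y. dist (h x) (h y) = dist x y"
  shows "surj h"
proof -
  have "orthogonal_transformation h" using h by (simp add: orthogonal_transformation_isometry)
  then have lin: "linear h" by (rule orthogonal_transformation_linear)
  have inj: "inj h" using h(2) by (metis dist_eq_0_iff injI)
  obtain B :: "'e set" where B: "orthonormal_basis inner B"
    using orthonormal_basis_inner_exists fd by blast
  interpret finite_dimensional_vector_space "scaleR :: real \<Rightarrow> 'e \<Rightarrow> 'e" B
    using dot.orthonormal_independent[OF B] B
    by unfold_locales (auto simp: orthonormal_basis_def span_raw_def dependent_raw_def)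
  show ?thesis
    using linear_inj_imp_surj[OF _ inj] lin by (simp add: linear_def real_scaleR_def)
qed


section \<open>The metric characterisation\<close>

lemma isometry_onto_inv:
  assumes "isometry_onto M d M d F"
  shows "isometry_onto M d M d (inv_into M F)"
proof -
  have bij: "bij_betw F M M" and iso: "\<And>x y. x \<in> M \<Longrightarrow> y \<in> M \<Longrightarrow> d (F x) (F y) = d x y"
    using assms by (auto simp: isometry_onto_def)
  have "bij_betw (inv_into M F) M M" using bij by (rule bij_betw_inv_into)
  moreover have "d (inv_into M F x) (inv_into M F y) = d x y" if "x \<in> M" "y \<in> M" for x y
    using iso[of "inv_into M F x" "inv_into M F y"] that bij calculation
    by (simp add: bij_betw_inv_into_right bij_betw_apply)
  ultimately show ?thesis by (auto simp: isometry_onto_def)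
qed

text \<open>The given dilation has an unknown centre \<open>S\<close>. Conjugating it by an isometry
  that takes \<open>S\<close> to \<open>p\<close> moves the centre and keeps the factor.\<close>

lemma homogeneous_dilation_at:
  assumes "homogeneous M d" "admits_dilations M d" "p \<in> M" "\<mu> > 0"
  shows "\<exists>\<delta>. is_dilation M d p \<mu> \<delta>"
proof -
  obtain S \<delta> where \<delta>: "is_dilation M d S \<mu> \<delta>"
    using assms by (auto simp: admits_dilations_def)
  then obtain F where F: "isometry_onto M d M d F" "F S = p"
    using assms(1,3) unfolding homogeneous_def is_dilation_def by metis
  note F' = isometry_onto_inv[OF F(1)]
  have "is_dilation M d p \<mu> (\<lambda>x. F (\<delta> (inv_into M F x)))"
    using \<delta> F F' assms(3)
    by (auto simp: is_dilation_def isometry_onto_def Pi_iff bij_betw_apply bij_betw_inv_into_left)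
  then show ?thesis by blast
qed

text \<open>The purely metric part: \<Psi> stands for an inverse chart normalised at
  \<open>p\<close> and \<Phi> for the chart. In \<open>loc\<close> the last clause converts
  smallness of \<open>d p q\<close> into membership of the chart ball.\<close>

lemma homogeneous_dilation_isometric:
  fixes \<Phi> :: "'a \<Rightarrow> 'e::real_inner" and \<Psi> :: "'e \<Rightarrow> 'a"
  assumes fd: "\<exists>B :: 'e::real_inner set. finite B \<and> span B = UNIV"
    and hom: "homogeneous M d" and dil: "admits_dilations M d"
    and p: "p \<in> M" "\<Psi> 0 = p"
    and loc: "\<And>\<epsilon>. 0 < \<epsilon> \<Longrightarrow> \<epsilon> < 1 \<Longrightarrow> \<exists>r>0.
        (\<forall>x\<in>ball 0 r. \<Psi> x \<in> M \<and> \<Phi> (\<Psi> x) = x) \<and>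
        (\<forall>x\<in>ball 0 r. \<forall>y\<in>ball 0 r. (1 - \<epsilon>) * dist x y \<le> d (\<Psi> x) (\<Psi> y) \<and>
           d (\<Psi> x) (\<Psi> y) \<le> (1 + \<epsilon>) * dist x y) \<and>
        (\<forall>q\<in>M. d p q < (1 - \<epsilon>) * r \<longrightarrow> q \<in> \<Psi> ` ball 0 r)"
  shows "isometric M d (UNIV :: 'e set) dist"
proof -
  have \<Phi>p: "\<Phi> p = 0" using loc[of "1/2"] p by auto
  have iso_at: "\<exists>F. isometry_onto M d M d F \<and> F x = y" if "x \<in> M" "y \<in> M" for x y
    using hom that by (simp add: homogeneous_def)

  \<comment> \<open>\<open>d\<close> is just a function here, so separation of points has to come
    from \<open>loc\<close>: after moving \<open>x\<close> to \<open>p\<close>, the lower comparison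
    applies. It makes \<open>f\<close> injective below.\<close>
  have definite: "x = y" if "x \<in> M" "y \<in> M" "d x y = 0" for x y
  proof -
    obtain F where F: "isometry_onto M d M d F" "F x = p" using iso_at \<open>x \<in> M\<close> p by blast
    obtain r where r: "r > 0"
      "\<And>v w. v \<in> ball 0 r \<Longrightarrow> w \<in> ball 0 r \<Longrightarrow> (1 - 1/2) * dist v w \<le> d (\<Psi> v) (\<Psi> w)"
      "\<And>q. q \<in> M \<Longrightarrow> d p q < (1 - 1/2) * r \<Longrightarrow> q \<in> \<Psi> ` ball 0 r"
      using loc[of "1/2"] by auto
    have "F y \<in> M" "d p (F y) = 0"
      using F that by (auto simp: isometry_onto_def bij_betw_apply)
    then obtain v where v: "F y = \<Psi> v" "v \<in> ball 0 r" using r(1) r(3)[of "F y"] by auto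
    then have "dist 0 v \<le> 0"
      using r(2)[of 0 v] r(1) p(2) \<open>d p (F y) = 0\<close> by auto
    then have "F y = F x" using v p F by simp
    then show ?thesis using F that by (auto simp: isometry_onto_def bij_betw_def inj_on_def)
  qed

  have "\<exists>\<delta>. is_dilation M d p (1 / real (Suc n)) \<delta>" for n
    by (rule homogeneous_dilation_at[OF hom dil p(1)]) auto
  then obtain \<delta> where \<delta>: "\<And>n. is_dilation M d p (1 / real (Suc n)) (\<delta> n)" by metis
  have \<delta>M: "\<delta> n x \<in> M" if "x \<in> M" for n x using \<delta>[of n] that by (auto simp: is_dilation_def)
  have \<delta>p: "\<delta> n p = p" for n using \<delta>[of n] by (simp add: is_dilation_def)
  have \<delta>d: "d (\<delta> n x) (\<delta> n y) = d x y / real (Suc n)" if "x \<in> M" "y \<in> M" for n x y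
    using \<delta>[of n] that by (simp add: is_dilation_def)

  text \<open>The contractions \<open>\<delta> n\<close> move any two points into the region where \<open>\<Phi>\<close> is almost isometric.\<close>
  define F where "F n x = real (Suc n) *\<^sub>R \<Phi> (\<delta> n x)" for n x
  have F0: "F n p = 0" for n using \<delta>p \<Phi>p by (simp add: F_def)
  have lim: "(\<lambda>n. dist (F n x) (F n y)) \<longlonglongrightarrow> d x y" if xy: "x \<in> M" "y \<in> M" for x y
    unfolding F_def
    proof (rule tendsto_almost)
      fix \<epsilon> :: real assume \<epsilon>: "0 < \<epsilon>" "\<epsilon> < 1"
      then obtain r where r: "r > 0" "\<And>x. x \<in> ball 0 r \<Longrightarrow> \<Psi> x \<in> M \<and> \<Phi> (\<Psi> x) = x"
        "\<And>v w. v \<in> ball 0 r \<Longrightarrow> w \<in> ball 0 r \<Longrightarrow> (1 - \<epsilon>) * dist v w \<le> d (\<Psi> v) (\<Psi> w) \<and>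
           d (\<Psi> v) (\<Psi> w) \<le> (1 + \<epsilon>) * dist v w"
        "\<And>q. q \<in> M \<Longrightarrow> d p q < (1 - \<epsilon>) * r \<Longrightarrow> q \<in> \<Psi> ` ball 0 r"
        using loc[of \<epsilon>] by auto
      \<comment> \<open>Contraction makes the distance from \<open>p\<close> tend to 0, and the last
        clause of \<open>loc\<close> then places the point in the chart ball.\<close>
      have ev: "eventually (\<lambda>n. \<delta> n z \<in> \<Psi> ` ball 0 r) sequentially" if z: "z \<in> M" for z
      proof -
        have "(\<lambda>n. d p z / real (Suc n)) \<longlonglongrightarrow> 0"
          by (rule LIMSEQ_Suc[OF lim_const_over_n])
        then have "eventually (\<lambda>n. d p z / real (Suc n) < (1 - \<epsilon>) * r) sequentially"
          using \<epsilon> r(1) by (intro order_tendstoD(2)) auto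
        then show ?thesis
        proof eventually_elim
          case (elim n)
          then show ?case using \<delta>d[OF p(1) z, of n] \<delta>p \<delta>M[OF z] by (intro r(4)) auto
        qed
      qed
      show "eventually (\<lambda>n. (1 - \<epsilon>) * dist (real (Suc n) *\<^sub>R \<Phi> (\<delta> n x)) (real (Suc n) *\<^sub>R \<Phi> (\<delta> n y)) \<le> d x y \<and>
          d x y \<le> (1 + \<epsilon>) * dist (real (Suc n) *\<^sub>R \<Phi> (\<delta> n x)) (real (Suc n) *\<^sub>R \<Phi> (\<delta> n y))) sequentially"
        using ev[OF xy(1)] ev[OF xy(2)]
      proof eventually_elim
        case (elim n)
        then obtain v w where vw: "\<delta> n x = \<Psi> v" "\<delta> n y = \<Psi> w" "v \<in> ball 0 r" "w \<in> ball 0 r"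
          by blast
        have "dist (real (Suc n) *\<^sub>R \<Phi> (\<delta> n x)) (real (Suc n) *\<^sub>R \<Phi> (\<delta> n y)) = real (Suc n) * dist v w"
          unfolding vw(1,2) dist_norm using vw(3,4) r(2)
          by (simp add: scaleR_diff_right[symmetric] del: of_nat_Suc)
        moreover have "d x y = real (Suc n) * d (\<Psi> v) (\<Psi> w)"
          using \<delta>d[OF xy, of n] vw by (simp del: of_nat_Suc)
        moreover have "real (Suc n) * ((1 - \<epsilon>) * dist v w) \<le> real (Suc n) * d (\<Psi> v) (\<Psi> w)"
          "real (Suc n) * d (\<Psi> v) (\<Psi> w) \<le> real (Suc n) * ((1 + \<epsilon>) * dist v w)"
          using r(3)[OF vw(3,4)] by (auto intro!: mult_left_mono simp del: of_nat_Suc)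
        ultimately show ?case by (simp only: mult.left_commute)
      qed
    qed simp
  obtain f :: "'a \<Rightarrow> 'e" where f0: "f p = 0"
    and fiso: "\<And>x y. x \<in> M \<Longrightarrow> y \<in> M \<Longrightarrow> dist (f x) (f y) = d x y"
    using isometric_cluster_point[where F = F and M = M and d = d, OF fd lim p(1) F0] by blast

  have finj: "inj_on f M" using fiso definite by (intro inj_onI) (metis dist_self)

  text \<open>Dilations need not be surjective, so the image of \<open>f\<close> is compared with the whole space by
    blowing up \<open>\<Psi>\<close>: the limit \<open>h\<close> takes values in the closure of the image and is surjective.\<close>
  have "\<exists>\<Delta>. is_dilation M d p (real (Suc n)) \<Delta>" for n
    by (rule homogeneous_dilation_at[OF hom dil p(1)]) auto
  then obtain \<Delta> where \<Delta>: "\<And>n. is_dilation M d p (real (Suc n)) (\<Delta> n)" by metis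
  have \<Delta>M: "\<Delta> n x \<in> M" if "x \<in> M" for n x using \<Delta>[of n] that by (auto simp: is_dilation_def)
  have \<Delta>p: "\<Delta> n p = p" for n using \<Delta>[of n] by (simp add: is_dilation_def)
  have \<Delta>d: "d (\<Delta> n x) (\<Delta> n y) = real (Suc n) * d x y" if "x \<in> M" "y \<in> M" for n x y
    using \<Delta>[of n] that by (simp add: is_dilation_def)
  define s where "s n v = (1 / real (Suc n)) *\<^sub>R v" for n and v :: 'e
  \<comment> \<open>The default value 0 is \<open>f p\<close>, so \<open>H n v\<close> lies in the
    image of \<open>f\<close> for every \<open>n\<close>. For large \<open>n\<close> the first case
    applies, since \<open>s n v\<close> tends to 0.\<close>
  define H where "H n v = (if \<Psi> (s n v) \<in> M then f (\<Delta> n (\<Psi> (s n v))) else 0)" for n v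
  have H0: "H n 0 = 0" for n using p \<Delta>p f0 by (simp add: H_def s_def)
  have HM: "H n v \<in> f ` M" for n v
    using f0 p(1) \<Delta>M by (auto simp: H_def intro: rev_image_eqI[of p])
  have limH: "(\<lambda>n. dist (H n v) (H n w)) \<longlonglongrightarrow> dist v w" for v w
  proof (cases "v = w")
    case False
    then have vw: "dist v w > 0" by simp
    show ?thesis
    proof (rule tendstoI)
      fix e :: real assume e: "e > 0"
      \<comment> \<open>The minimum with \<open>1/2\<close> keeps \<epsilon> admissible for
        \<open>loc\<close>; the other term bounds the error \<open>\<epsilon> * dist v w\<close> by
        \<open>e / 2\<close>. Dividing by \<open>dist v w\<close> is the reason for the case
        distinction.\<close>
      define \<epsilon> where "\<epsilon> = min (1/2) (e / dist v w / 2)"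
      have \<epsilon>: "0 < \<epsilon>" "\<epsilon> < 1" using e vw by (auto simp: \<epsilon>_def)
      have "\<epsilon> * dist v w \<le> e / dist v w / 2 * dist v w"
        using vw by (intro mult_right_mono) (auto simp: \<epsilon>_def)
      then have small: "\<epsilon> * dist v w < e" using e vw by simp
      obtain r where r: "r > 0" "\<And>x. x \<in> ball 0 r \<Longrightarrow> \<Psi> x \<in> M"
        "\<And>v w. v \<in> ball 0 r \<Longrightarrow> w \<in> ball 0 r \<Longrightarrow> (1 - \<epsilon>) * dist v w \<le> d (\<Psi> v) (\<Psi> w) \<and>
           d (\<Psi> v) (\<Psi> w) \<le> (1 + \<epsilon>) * dist v w"
        using loc[OF \<epsilon>] by auto
      have ev: "eventually (\<lambda>n. s n u \<in> ball 0 r) sequentially" for u :: 'e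
      proof -
        have "(\<lambda>n. norm u / real (Suc n)) \<longlonglongrightarrow> 0"
          by (rule LIMSEQ_Suc[OF lim_const_over_n])
        then have "eventually (\<lambda>n. norm u / real (Suc n) < r) sequentially"
          using r(1) by (intro order_tendstoD(2)) auto
        then show ?thesis by (simp add: s_def)
      qed
      show "eventually (\<lambda>n. dist (dist (H n v) (H n w)) (dist v w) < e) sequentially"
        using ev[of v] ev[of w]
      proof eventually_elim
        case (elim n)
        have "dist (H n v) (H n w) = real (Suc n) * d (\<Psi> (s n v)) (\<Psi> (s n w))"
          using r(2) elim fiso \<Delta>M \<Delta>d by (simp add: H_def del: of_nat_Suc)
        moreover have "dist v w = real (Suc n) * dist (s n v) (s n w)"
          unfolding s_def dist_norm by (simp add: scaleR_diff_right[symmetric] del: of_nat_Suc)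
        moreover have "real (Suc n) * ((1 - \<epsilon>) * dist (s n v) (s n w)) \<le> real (Suc n) * d (\<Psi> (s n v)) (\<Psi> (s n w))"
          "real (Suc n) * d (\<Psi> (s n v)) (\<Psi> (s n w)) \<le> real (Suc n) * ((1 + \<epsilon>) * dist (s n v) (s n w))"
          using r(3)[OF elim] by (auto intro!: mult_left_mono simp del: of_nat_Suc)
        ultimately have "(1 - \<epsilon>) * dist v w \<le> dist (H n v) (H n w)"
            "dist (H n v) (H n w) \<le> (1 + \<epsilon>) * dist v w"
          by (simp_all only: mult.left_commute)
        then have "\<bar>dist (H n v) (H n w) - dist v w\<bar> \<le> \<epsilon> * dist v w"
          by (auto simp: algebra_simps abs_le_iff)
        then show ?case using small by (simp add: dist_real_def)
      qed
    qed
  qed simp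
  obtain h :: "'e \<Rightarrow> 'e" where h0: "h 0 = 0" and hiso: "\<And>v w. dist (h v) (h w) = dist v w"
    and hcl: "\<And>v. h v \<in> closure (range (\<lambda>n. H n v))"
    using isometric_cluster_point[where F = H and M = UNIV and d = dist, OF fd limH UNIV_I H0]
    by blast
  have dense: "y \<in> closure (f ` M)" for y
  proof -
    obtain v where v: "y = h v"
      using isometry_finite_dim_surj[OF fd h0 hiso] by (metis surjD)
    have "range (\<lambda>n. H n v) \<subseteq> f ` M" using HM by auto
    then show ?thesis using hcl[of v] v closure_mono by blast
  qed

  obtain r where r: "r > 0" "\<And>x. x \<in> ball 0 r \<Longrightarrow> \<Psi> x \<in> M"
    "\<And>v w. v \<in> ball 0 r \<Longrightarrow> w \<in> ball 0 r \<Longrightarrow> (1 - 1/2) * dist v w \<le> d (\<Psi> v) (\<Psi> w) \<and>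
       d (\<Psi> v) (\<Psi> w) \<le> (1 + 1/2) * dist v w"
    "\<And>q. q \<in> M \<Longrightarrow> d p q < (1 - 1/2) * r \<Longrightarrow> q \<in> \<Psi> ` ball 0 r"
    using loc[of "1/2"] by auto
  text \<open>By homogeneity, \<open>f\<close> maps balls of a fixed radius around every point into compact subsets of its
    image; together with density this gives surjectivity.\<close>
  have surj: "y \<in> f ` M" for y
  proof -
    obtain q where q: "q \<in> M" "dist (f q) y < r / 4"
      using dense[of y] r(1) unfolding closure_approachable
      by (metis divide_pos_pos imageE zero_less_numeral)
    obtain F where F: "isometry_onto M d M d F" "F p = q" using iso_at p q by blast
    have FM: "F x \<in> M" if "x \<in> M" for x
      using F that by (auto simp: isometry_onto_def bij_betw_apply)
    \<comment> \<open>A point of the image at distance less than \<open>r / 4\<close> from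
      \<open>f q\<close> comes from some \<open>m'\<close> with \<open>d p m' < r / 4\<close>. This
      is below \<open>(1 - 1/2) * r\<close>, so \<open>m' = \<Psi> v\<close>, and the lower
      comparison gives \<open>norm v \<le> r / 2\<close>: the parameter stays in a compact ball
      inside the chart ball.\<close>
    define K where "K = (\<lambda>v. f (F (\<Psi> v))) ` cball 0 (r / 2)"
    have "(1 + 1/2)-lipschitz_on (cball 0 (r / 2)) (\<lambda>v. f (F (\<Psi> v)))"
    proof (rule lipschitz_onI)
      fix v w :: 'e assume vw: "v \<in> cball 0 (r / 2)" "w \<in> cball 0 (r / 2)"
      then have b: "v \<in> ball 0 r" "w \<in> ball 0 r" using r(1) by auto
      then have "dist (f (F (\<Psi> v))) (f (F (\<Psi> w))) = d (\<Psi> v) (\<Psi> w)"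
        using r(2) FM fiso F by (simp add: isometry_onto_def)
      then show "dist (f (F (\<Psi> v))) (f (F (\<Psi> w))) \<le> (1 + 1/2) * dist v w"
        using r(3)[OF b] by simp
    qed simp
    then have "compact K" unfolding K_def
      by (intro compact_continuous_image lipschitz_on_continuous_on compact_cball_finite_dim[OF fd])
    then have "closed K" by (rule compact_imp_closed)
    moreover have "f ` M \<inter> ball (f q) (r / 4) \<subseteq> K"
    proof
      fix z assume "z \<in> f ` M \<inter> ball (f q) (r / 4)"
      then obtain m where m: "m \<in> M" "dist (f q) (f m) < r / 4" and z: "z = f m" by auto
      have "m \<in> F ` M" using F(1) m(1) by (simp add: isometry_onto_def bij_betw_def)
      then obtain m' where m': "m' \<in> M" "m = F m'" by blast
      have "d (F p) (F m') = d p m'" using F(1) p(1) m'(1) by (simp add: isometry_onto_def)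
      then have dpm: "d p m' < r / 4"
        using m m'(2) fiso[OF q(1) m(1)] F(2) by simp
      then obtain v where v: "m' = \<Psi> v" "v \<in> ball 0 r"
        using r(4)[of m'] m'(1) r(1) by auto
      have "(1 - 1/2) * dist 0 v \<le> r / 4"
        using r(3)[of 0 v] v r(1) p(2) dpm by auto
      then have "v \<in> cball 0 (r / 2)" by simp
      then show "z \<in> K" using v m' z by (auto simp: K_def)
    qed
    moreover have "y \<in> closure (f ` M \<inter> ball (f q) (r / 4))"
      using open_Int_closure_subset[of "ball (f q) (r / 4)" "f ` M"] dense[of y] q(2)
      by (auto simp: Int_commute)
    ultimately have "y \<in> K" by (meson closure_minimal subsetD)
    then show ?thesis using r(1,2) FM by (auto simp: K_def)
  qed
  have "isometry_onto M d UNIV dist f"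
    using surj finj fiso by (auto simp: isometry_onto_def bij_betw_def)
  then show ?thesis unfolding isometric_def by blast
qed


section \<open>Piecewise smooth paths\<close>

lemma pathin_cases_half:
  assumes "pathin X \<gamma>1" "pathin X \<gamma>2" "\<gamma>1 1 = \<gamma>2 0"
  shows "pathin X (\<lambda>t. if t \<le> 1/2 then \<gamma>1 (2 * t) else \<gamma>2 (2 * t - 1))"
  unfolding pathin_def
proof (rule continuous_map_cases_le)
  have c: "continuous_map (subtopology (top_of_set {0..1}) S) X (\<lambda>t. \<gamma> (f t))"
    if "pathin X \<gamma>" "\<And>t. t \<in> S \<Longrightarrow> t \<in> {0..1} \<Longrightarrow> f t \<in> {0..1}" "continuous_on UNIV f"
    for \<gamma> S and f :: "real \<Rightarrow> real"
  proof -
    have "continuous_map (top_of_set ({0..1} \<inter> S)) (top_of_set {0..1}) f"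
      using that(2) continuous_on_subset[OF that(3)]
      by (auto simp: continuous_map_in_subtopology)
    then have "continuous_map (top_of_set ({0..1} \<inter> S)) X (\<gamma> \<circ> f)"
      using that(1) unfolding pathin_def by (rule continuous_map_compose)
    then show ?thesis by (simp add: o_def subtopology_subtopology)
  qed
  show "continuous_map (subtopology (top_of_set {0..1}) {x \<in> topspace (top_of_set {0..1}). x \<le> 1/2})
      X (\<lambda>t. \<gamma>1 (2 * t))"
    by (rule c[OF assms(1)]) (auto intro!: continuous_intros)
  show "continuous_map (subtopology (top_of_set {0..1}) {x \<in> topspace (top_of_set {0..1}). 1/2 \<le> x})
      X (\<lambda>t. \<gamma>2 (2 * t - 1))"
    by (rule c[OF assms(2)]) (auto intro!: continuous_intros)
  show "\<gamma>1 (2 * t) = \<gamma>2 (2 * t - 1)" if "t = 1/2" for t unfolding that using assms(3) by simp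
qed (auto intro: continuous_map_from_subtopology)

text \<open>Applied to the two halves of a concatenation, with \<open>m = 2\<close> and
  \<open>k\<close> equal to \<open>0\<close> or \<open>- 1\<close>.\<close>

lemma C1_path_on_affine:
  assumes "C1_path_on A (m * a + k) (m * b + k) \<gamma>" "m > 0"
  shows "C1_path_on A a b (\<lambda>t. \<gamma> (m * t + k))"
  unfolding C1_path_on_def Let_def
proof
  fix c assume "c \<in> A"
  define J where "J = {t \<in> {a..b}. \<gamma> (m * t + k) \<in> fst c}"
  define J' where "J' = {t \<in> {m * a + k..m * b + k}. \<gamma> t \<in> fst c}"
  obtain v where v: "continuous_on J' v"
    "\<And>t. t \<in> J' \<Longrightarrow> (snd c \<circ> \<gamma> has_vector_derivative v t) (at t within J')"
    using assms(1) \<open>c \<in> A\<close> unfolding C1_path_on_def Let_def J'_def by blast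
  have sub: "(\<lambda>t. m * t + k) ` J \<subseteq> J'" using assms(2) by (auto simp: J_def J'_def)
  have "continuous_on J (\<lambda>t. m *\<^sub>R v (m * t + k))"
    by (intro continuous_intros continuous_on_compose2[OF v(1) _ sub])
  moreover have "(snd c \<circ> (\<lambda>t. \<gamma> (m * t + k)) has_vector_derivative m *\<^sub>R v (m * t + k)) (at t within J)"
    if "t \<in> J" for t
  proof -
    have "((\<lambda>t. m * t + k) has_vector_derivative m) (at t within J)"
      by (auto intro!: derivative_eq_intros)
    moreover have "(snd c \<circ> \<gamma> has_vector_derivative v (m * t + k)) (at (m * t + k) within (\<lambda>t. m * t + k) ` J)"
      using v(2)[of "m * t + k"] sub that by (blast intro: has_vector_derivative_within_subset)
    ultimately have "((snd c \<circ> \<gamma>) \<circ> (\<lambda>t. m * t + k) has_vector_derivative m *\<^sub>R v (m * t + k)) (at t within J)"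
      by (rule vector_diff_chain_within)
    then show ?thesis by (simp add: o_def)
  qed
  ultimately show "\<exists>v. continuous_on {t \<in> {a..b}. \<gamma> (m * t + k) \<in> fst c} v \<and>
      (\<forall>t\<in>{t \<in> {a..b}. \<gamma> (m * t + k) \<in> fst c}.
        (snd c \<circ> (\<lambda>t. \<gamma> (m * t + k)) has_vector_derivative v t)
         (at t within {t \<in> {a..b}. \<gamma> (m * t + k) \<in> fst c}))"
    unfolding J_def[symmetric] by blast
qed

lemma C1_path_on_cong:
  assumes "C1_path_on A a b \<gamma>" "\<And>t. t \<in> {a..b} \<Longrightarrow> \<gamma>' t = \<gamma> t"
  shows "C1_path_on A a b \<gamma>'"
  unfolding C1_path_on_def Let_def
proof
  fix c assume "c \<in> A"
  define J where "J = {t \<in> {a..b}. \<gamma> t \<in> fst c}"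
  have J: "{t \<in> {a..b}. \<gamma>' t \<in> fst c} = J" using assms(2) by (auto simp: J_def)
  obtain v where v: "continuous_on J v"
    "\<And>t. t \<in> J \<Longrightarrow> (snd c \<circ> \<gamma> has_vector_derivative v t) (at t within J)"
    using assms(1) \<open>c \<in> A\<close> unfolding C1_path_on_def Let_def J_def by blast
  have "(snd c \<circ> \<gamma>' has_vector_derivative v t) (at t within J)" if "t \<in> J" for t
    by (rule has_vector_derivative_transform[OF that _ v(2)[OF that]]) (auto simp: J_def assms(2))
  then show "\<exists>v. continuous_on {t \<in> {a..b}. \<gamma>' t \<in> fst c} v \<and>
      (\<forall>t\<in>{t \<in> {a..b}. \<gamma>' t \<in> fst c}. (snd c \<circ> \<gamma>' has_vector_derivative v t)
         (at t within {t \<in> {a..b}. \<gamma>' t \<in> fst c}))"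
    unfolding J using v(1) by blast
qed

lemma piecewise_C1_path_join:
  assumes "piecewise_C1_path X A \<gamma>1" "piecewise_C1_path X A \<gamma>2" "\<gamma>1 1 = \<gamma>2 0"
  shows "piecewise_C1_path X A (\<lambda>t. if t \<le> 1/2 then \<gamma>1 (2 * t) else \<gamma>2 (2 * t - 1))"
    (is "piecewise_C1_path X A ?\<gamma>")
proof -
  obtain T1 T2 where T: "finite T1" "finite T2"
    and T1: "\<And>a b. 0 \<le> a \<Longrightarrow> a < b \<Longrightarrow> b \<le> 1 \<Longrightarrow> {a<..<b} \<inter> T1 = {} \<Longrightarrow> C1_path_on A a b \<gamma>1"
    and T2: "\<And>a b. 0 \<le> a \<Longrightarrow> a < b \<Longrightarrow> b \<le> 1 \<Longrightarrow> {a<..<b} \<inter> T2 = {} \<Longrightarrow> C1_path_on A a b \<gamma>2"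
    using assms(1,2) unfolding piecewise_C1_path_def by metis
  \<comment> \<open>Break points of both pieces in the new parameter, together with the junction.
    Including \<open>1/2\<close> forces an interval without interior break points into one
    half.\<close>
  define T where "T = (\<lambda>t. t / 2) ` T1 \<union> {1/2} \<union> (\<lambda>t. (t + 1) / 2) ` T2"
  have "C1_path_on A a b ?\<gamma>" if ab: "0 \<le> a" "a < b" "b \<le> 1" "{a<..<b} \<inter> T = {}" for a b
  proof -
    have "1/2 \<notin> {a<..<b}" using ab by (auto simp: T_def)
    then consider "b \<le> 1/2" | "a \<ge> 1/2" by force
    then show ?thesis
    proof cases
      case 1
      have "{2 * a + 0<..<2 * b + 0} \<inter> T1 = {}"
      proof (rule ccontr)
        assume "{2 * a + 0<..<2 * b + 0} \<inter> T1 \<noteq> {}"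
        then obtain t where "t \<in> T1" "2 * a < t" "t < 2 * b" by auto
        then have "t / 2 \<in> {a<..<b} \<inter> T" by (auto simp: T_def)
        then show False using ab by blast
      qed
      then have "C1_path_on A (2 * a + 0) (2 * b + 0) \<gamma>1"
        using ab 1 by (intro T1) auto
      from C1_path_on_affine[OF this] have "C1_path_on A a b (\<lambda>t. \<gamma>1 (2 * t + 0))" by simp
      then show ?thesis by (rule C1_path_on_cong) (use 1 in auto)
    next
      case 2
      have "{2 * a + - 1<..<2 * b + - 1} \<inter> T2 = {}"
      proof (rule ccontr)
        assume "{2 * a + - 1<..<2 * b + - 1} \<inter> T2 \<noteq> {}"
        then obtain t where "t \<in> T2" "2 * a - 1 < t" "t < 2 * b - 1" by auto
        then have "(t + 1) / 2 \<in> {a<..<b} \<inter> T" by (auto simp: T_def)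
        then show False using ab by blast
      qed
      then have "C1_path_on A (2 * a + - 1) (2 * b + - 1) \<gamma>2"
        using ab 2 by (intro T2) auto
      from C1_path_on_affine[OF this] have "C1_path_on A a b (\<lambda>t. \<gamma>2 (2 * t + - 1))" by simp
      \<comment> \<open>If \<open>a = 1/2\<close>, the case distinction still selects
        \<open>\<gamma>1\<close> at \<open>t = a\<close>; the two formulas agree there because the
        paths match.\<close>
      moreover have "?\<gamma> t = \<gamma>2 (2 * t + - 1)" if "t \<in> {a..b}" for t
      proof (cases "t = 1/2")
        case True
        show ?thesis unfolding True using assms(3) by simp
      qed (use that 2 in auto)
      ultimately show ?thesis by (rule C1_path_on_cong)
    qed
  qed
  moreover have "finite T" using T by (simp add: T_def)
  moreover have "pathin X ?\<gamma>"
    using assms by (intro pathin_cases_half) (auto simp: piecewise_C1_path_def)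
  ultimately show ?thesis unfolding piecewise_C1_path_def by blast
qed

text \<open>Smoothness of the metric is stated for fixed vectors. The expansion reduces estimates
  and continuity with varying vectors to finitely many coefficient functions.\<close>

lemma bilinear_orthonormal_expansion:
  fixes h :: "'e::real_inner \<Rightarrow> 'e \<Rightarrow> real"
  assumes bil: "bilinear h" and B: "orthonormal_basis inner B"
  shows "h v w = (\<Sum>a\<in>B. \<Sum>b\<in>B. (v \<bullet> a) * (w \<bullet> b) * h a b)"
proof -
  have lin: "linear (h a)" "linear (\<lambda>x. h x a)" for a using bil by (auto simp: bilinear_def)
  have "h v w = h (\<Sum>a\<in>B. (v \<bullet> a) *\<^sub>R a) (\<Sum>b\<in>B. (w \<bullet> b) *\<^sub>R b)"
    using dot.orthonormal_expansion[OF B] by simp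
  also have "\<dots> = (\<Sum>a\<in>B. (v \<bullet> a) * h a (\<Sum>b\<in>B. (w \<bullet> b) *\<^sub>R b))"
    by (simp only: linear_sum[OF lin(2)] linear_cmul[OF lin(2)] real_scaleR_def)
  also have "\<dots> = (\<Sum>a\<in>B. \<Sum>b\<in>B. (v \<bullet> a) * (w \<bullet> b) * h a b)"
    by (simp only: linear_sum[OF lin(1)] linear_cmul[OF lin(1)] real_scaleR_def
        sum_distrib_left mult.assoc)
  finally show ?thesis .
qed

section \<open>Charts, transition maps and paths near a chart\<close>

context smooth_manifold
begin

lemma
  assumes "c \<in> A"
  shows chart_open: "openin X (fst c)" and chart_image_open: "open (snd c ` fst c)"
    and chart_inj: "inj_on (snd c) (fst c)"
    and chart_homeo: "homeomorphic_map (subtopology X (fst c)) (top_of_set (snd c ` fst c)) (snd c)"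
    and chart_subset: "fst c \<subseteq> topspace X"
proof -
  have "is_chart X c" using charts assms by blast
  then show 1: "openin X (fst c)" and "open (snd c ` fst c)"
    and 2: "homeomorphic_map (subtopology X (fst c)) (top_of_set (snd c ` fst c)) (snd c)"
    by (auto simp: is_chart_def)
  show "fst c \<subseteq> topspace X" using 1 by (rule openin_subset)
  then show "inj_on (snd c) (fst c)"
    using homeomorphic_imp_injective_map[OF 2] by (simp add: Int_absorb1)
qed

lemma chart_inv:
  assumes "c \<in> A"
  shows "q \<in> fst c \<Longrightarrow> inv_into (fst c) (snd c) (snd c q) = q"
    and "x \<in> snd c ` fst c \<Longrightarrow> snd c (inv_into (fst c) (snd c) x) = x"
    and "x \<in> snd c ` fst c \<Longrightarrow> inv_into (fst c) (snd c) x \<in> fst c"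
  using chart_inj[OF assms] by (auto simp: f_inv_into_f inv_into_into)

lemma chart_continuous:
  assumes "c \<in> A"
  shows "continuous_map (subtopology X (fst c)) euclidean (snd c)"
  using homeomorphic_imp_continuous_map[OF chart_homeo[OF assms]]
  by (simp add: continuous_map_in_subtopology)

lemma chart_inv_continuous:
  assumes "c \<in> A"
  shows "continuous_map (top_of_set (snd c ` fst c)) X (inv_into (fst c) (snd c))"
proof -
  obtain h where h: "homeomorphic_maps (subtopology X (fst c)) (top_of_set (snd c ` fst c)) (snd c) h"
    using chart_homeo[OF assms] by (auto simp: homeomorphic_map_maps)
  then have "continuous_map (top_of_set (snd c ` fst c)) X h"
    by (auto simp: homeomorphic_maps_def continuous_map_in_subtopology)
  moreover have "h x = inv_into (fst c) (snd c) x" if "x \<in> snd c ` fst c" for x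
    using h that chart_inj[OF assms] chart_subset[OF assms]
    by (auto simp: homeomorphic_maps_def topspace_subtopology_subset)
  ultimately show ?thesis
    by (rule continuous_map_eq) auto
qed

lemma transition_derivative:
  assumes "c \<in> A" "c' \<in> A"
  shows "x \<in> snd c ` (fst c \<inter> fst c') \<Longrightarrow>
      (transition c c' has_derivative frechet_derivative (transition c c') (at x)) (at x)"
    and "continuous_on (snd c ` (fst c \<inter> fst c')) (\<lambda>x. frechet_derivative (transition c c') (at x) v)"
proof -
  have "Ck_on (Suc 0) (snd c ` (fst c \<inter> fst c')) (transition c c')"
    using compatible[OF assms] unfolding smooth_on_def by blast
  then show "x \<in> snd c ` (fst c \<inter> fst c') \<Longrightarrow>
      (transition c c' has_derivative frechet_derivative (transition c c') (at x)) (at x)"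
    "continuous_on (snd c ` (fst c \<inter> fst c')) (\<lambda>x. frechet_derivative (transition c c') (at x) v)"
    by (auto simp: frechet_derivative_works)
qed

lemma transition_apply:
  assumes "c \<in> A" "q \<in> fst c"
  shows "transition c c' (snd c q) = snd c' q"
  using chart_inv(1)[OF assms] by (simp add: transition_def)

lemma pathin_nhds:
  assumes "pathin X \<gamma>" "openin X U" "t \<in> {0..1}" "\<gamma> t \<in> U"
  obtains d where "d > 0" "\<And>s. s \<in> {0..1} \<Longrightarrow> \<bar>s - t\<bar> < d \<Longrightarrow> \<gamma> s \<in> U"
proof -
  have "openin (top_of_set {0..1}) {s \<in> topspace (top_of_set {0..1}). \<gamma> s \<in> U}"
    using assms(1,2) unfolding pathin_def by (rule openin_continuous_map_preimage)
  then obtain d where "d > 0" "\<And>s. s \<in> {0..1} \<Longrightarrow> dist s t < d \<Longrightarrow> \<gamma> s \<in> U"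
    using assms(3,4) unfolding openin_euclidean_subtopology_iff by force
  then show thesis by (intro that[of d]) (auto simp: dist_real_def)
qed

lemma piecewise_C1_path_local:
  assumes "pathin X \<gamma>" "finite T" "c \<in> A" "t \<in> {0..1}" "\<gamma> t \<in> fst c"
  obtains d where "d > 0" "\<And>s. s \<in> {0..1} \<Longrightarrow> \<bar>s - t\<bar> < d \<Longrightarrow> \<gamma> s \<in> fst c"
    "\<And>s. s \<in> T \<Longrightarrow> s \<noteq> t \<Longrightarrow> d \<le> \<bar>s - t\<bar>"
proof -
  obtain d1 where d1: "d1 > 0" "\<And>s. s \<in> {0..1} \<Longrightarrow> \<bar>s - t\<bar> < d1 \<Longrightarrow> \<gamma> s \<in> fst c"
    using pathin_nhds[OF assms(1) chart_open[OF assms(3)] assms(4,5)] by blast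
  obtain d2 where d2: "d2 > 0" "\<And>s. s \<in> T \<Longrightarrow> s \<noteq> t \<Longrightarrow> d2 \<le> \<bar>s - t\<bar>"
    using finite_set_avoid[OF assms(2), of t] by (auto simp: dist_real_def abs_minus_commute)
  show thesis
    by (rule that[of "min d1 d2"]) (use d1 d2 in \<open>auto simp: min_le_iff_disj\<close>)
qed

lemma C1_path_on_in_chart:
  assumes "C1_path_on A a b \<gamma>" "c \<in> A" "\<gamma> ` {a..b} \<subseteq> fst c"
  obtains v where "continuous_on {a..b} v"
    "\<And>t. t \<in> {a..b} \<Longrightarrow> (snd c \<circ> \<gamma> has_vector_derivative v t) (at t within {a..b})"
proof -
  have "{t \<in> {a..b}. \<gamma> t \<in> fst c} = {a..b}" using assms(3) by auto
  then show thesis using assms(1,2) that unfolding C1_path_on_def Let_def by force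
qed

text \<open>\<open>C1_path_on\<close> yields derivatives relative to a closed interval. On an
  interval centred at \<open>t\<close> that avoids \<open>T\<close> and stays in the chart, the
  derivative at \<open>t\<close> is two-sided.\<close>

lemma piecewise_C1_path_derivative:
  assumes "pathin X \<gamma>" "finite T"
    and T: "\<And>a b. 0 \<le> a \<Longrightarrow> a < b \<Longrightarrow> b \<le> 1 \<Longrightarrow> {a<..<b} \<inter> T = {} \<Longrightarrow> C1_path_on A a b \<gamma>"
    and "c \<in> A" "t \<in> {0<..<1} - T" "\<gamma> t \<in> fst c"
  obtains v where "(snd c \<circ> \<gamma> has_vector_derivative v) (at t)"
proof -
  obtain d where d: "d > 0" "\<And>s. s \<in> {0..1} \<Longrightarrow> \<bar>s - t\<bar> < d \<Longrightarrow> \<gamma> s \<in> fst c"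
    "\<And>s. s \<in> T \<Longrightarrow> s \<noteq> t \<Longrightarrow> d \<le> \<bar>s - t\<bar>"
    using piecewise_C1_path_local[OF assms(1,2,4), of t] assms(5,6) by auto
  define e where "e = min (d / 2) (min t (1 - t))"
  have e: "0 < e" "e < d" "0 \<le> t - e" "t + e \<le> 1" using d(1) assms(5) by (auto simp: e_def)
  have "{t - e<..<t + e} \<inter> T = {}"
  proof (rule ccontr)
    assume "{t - e<..<t + e} \<inter> T \<noteq> {}"
    then obtain s where "s \<in> T" "t - e < s" "s < t + e" by auto
    moreover have "s \<noteq> t" using \<open>s \<in> T\<close> assms(5) by auto
    ultimately show False using d(3)[of s] e by auto
  qed
  then have "C1_path_on A (t - e) (t + e) \<gamma>" using e by (intro T) auto
  moreover have "\<gamma> ` {t - e..t + e} \<subseteq> fst c"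
    using e by (auto intro!: d(2))
  ultimately obtain v where "\<And>s. s \<in> {t - e..t + e} \<Longrightarrow>
      (snd c \<circ> \<gamma> has_vector_derivative v s) (at s within {t - e..t + e})"
    using C1_path_on_in_chart[OF _ assms(4)] by blast
  then have "(snd c \<circ> \<gamma> has_vector_derivative v t) (at t within {t - e..t + e})" using e by simp
  then show thesis using that e by (simp add: at_within_Icc_at)
qed

end

section \<open>Speed, length and their chart-independence\<close>

context riemannian_manifold
begin

text \<open>\<open>path_speed\<close> picks some chart \<open>c'\<close> by choice. The chain rule
  turns the velocity \<open>u\<close> into \<open>D u\<close>, with \<open>D\<close> the derivative
  of the transition map, and \<open>tensor\<close> is exactly the matching rule for the
  metric.\<close>

lemma path_speed_in_chart:
  assumes "pathin X \<gamma>" "t \<in> {0<..<1}" "c \<in> A" "\<gamma> t \<in> fst c"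
    and u: "(snd c \<circ> \<gamma> has_vector_derivative u) (at t)"
  shows "path_speed A g \<gamma> t = sqrt (g c (\<gamma> t) u u)"
proof -
  define c' where "c' = (SOME c. c \<in> A \<and> \<gamma> t \<in> fst c)"
  have c': "c' \<in> A \<and> \<gamma> t \<in> fst c'" unfolding c'_def by (rule someI[of _ c]) (use assms in auto)
  define D where "D = frechet_derivative (transition c c') (at (snd c (\<gamma> t)))"
  have "(transition c c' has_derivative D) (at (snd c (\<gamma> t)))"
    unfolding D_def using transition_derivative(1)[OF assms(3)] c' assms(4) by blast
  then have \<tau>: "(transition c c' \<circ> (snd c \<circ> \<gamma>) has_vector_derivative D u) (at t)"
    using vector_derivative_diff_chain_within[OF u] has_derivative_at_withinI by (metis comp_apply)
  obtain d where d: "d > 0" "\<And>s. s \<in> {0..1} \<Longrightarrow> \<bar>s - t\<bar> < d \<Longrightarrow> \<gamma> s \<in> fst c"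
    using pathin_nhds[OF assms(1) chart_open[OF assms(3)] _ assms(4)] assms(2) by auto
  have eq: "(transition c c' \<circ> (snd c \<circ> \<gamma>)) s = (snd c' \<circ> \<gamma>) s" if "s \<in> {0<..<1} \<inter> ball t d" for s
  proof -
    have "\<gamma> s \<in> fst c" using that d(2)[of s] by (auto simp: dist_real_def abs_minus_commute)
    then show ?thesis using transition_apply[OF assms(3)] by simp
  qed
  have "open ({0<..<1} \<inter> ball t d)" "t \<in> {0<..<1} \<inter> ball t d" using assms(2) d(1) by auto
  from has_vector_derivative_transform_within_open[OF \<tau> this eq]
  have "(snd c' \<circ> \<gamma> has_vector_derivative D u) (at t)" .
  moreover have "at t within {0..1} = at t" using assms(2) by (simp add: at_within_Icc_at)
  ultimately have "vector_derivative (snd c' \<circ> \<gamma>) (at t within {0..1}) = D u"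
    by (simp add: vector_derivative_at)
  then have "path_speed A g \<gamma> t = sqrt (g c' (\<gamma> t) (D u) (D u))"
    by (simp add: path_speed_def Let_def c'_def)
  also have "g c' (\<gamma> t) (D u) (D u) = g c (\<gamma> t) u u"
    using tensor[of c c' "\<gamma> t" u u] assms c' by (simp add: D_def)
  finally show ?thesis .
qed

lemma path_speed_nonneg:
  assumes "pathin X \<gamma>" "t \<in> {0..1}"
  shows "path_speed A g \<gamma> t \<ge> 0"
proof -
  have "\<gamma> t \<in> topspace X"
    using assms continuous_map_image_subset_topspace[of "top_of_set {0..1}" X \<gamma>]
    by (auto simp: pathin_def)
  then obtain c where "c \<in> A \<and> \<gamma> t \<in> fst c" using covers by auto
  then have c: "(SOME c. c \<in> A \<and> \<gamma> t \<in> fst c) \<in> A \<and> \<gamma> t \<in> fst (SOME c. c \<in> A \<and> \<gamma> t \<in> fst c)"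
    by (rule someI)
  have "g c q v v \<ge> 0" if "c \<in> A" "q \<in> fst c" for c q v
    using positive[OF that, of v] bilinear[OF that] bilinear_lzero by (cases "v = 0") fastforce+
  then show ?thesis using c unfolding path_speed_def Let_def by simp
qed

lemma metric_continuous:
  assumes "c \<in> A"
  shows "continuous_on (snd c ` fst c) (\<lambda>x. g c (inv_into (fst c) (snd c) x) v w)"
  using smooth[OF assms, of v w] unfolding smooth_on_def by (metis Ck_on.simps(1))

lemma metric_continuous_along:
  assumes c: "c \<in> A" and y: "continuous_on J y" "y ` J \<subseteq> snd c ` fst c" and v: "continuous_on J v"
  shows "continuous_on J (\<lambda>t. g c (inv_into (fst c) (snd c) (y t)) (v t) (v t))"
proof -
  obtain B :: "'e set" where B: "orthonormal_basis inner B"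
    using orthonormal_basis_inner_exists finite_dim by blast
  have "continuous_on J (\<lambda>t. \<Sum>a\<in>B. \<Sum>b\<in>B. (v t \<bullet> a) * (v t \<bullet> b) *
      g c (inv_into (fst c) (snd c) (y t)) a b)"
    by (intro continuous_intros v continuous_on_compose2[OF metric_continuous[OF c] y])
  moreover have "inv_into (fst c) (snd c) (y t) \<in> fst c" if "t \<in> J" for t
    using y(2) that by (intro chart_inv(3)[OF c]) auto
  ultimately show ?thesis
    by (simp add: bilinear_orthonormal_expansion[OF bilinear[OF c] B])
qed

lemma path_speed_integrable_C1:
  assumes "pathin X \<gamma>" "0 \<le> a" "b \<le> 1" "C1_path_on A a b \<gamma>" "c \<in> A" "\<gamma> ` {a..b} \<subseteq> fst c"
  shows "path_speed A g \<gamma> integrable_on {a..b}"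
proof -
  obtain v where v: "continuous_on {a..b} v"
    "\<And>t. t \<in> {a..b} \<Longrightarrow> (snd c \<circ> \<gamma> has_vector_derivative v t) (at t within {a..b})"
    using C1_path_on_in_chart[OF assms(4-6)] by blast
  have cont: "continuous_on {a..b} (snd c \<circ> \<gamma>)"
    using v(2) by (meson continuous_on_eq_continuous_within has_vector_derivative_continuous)
  have "continuous_on {a..b} (\<lambda>t. g c (inv_into (fst c) (snd c) ((snd c \<circ> \<gamma>) t)) (v t) (v t))"
    using assms(6) by (intro metric_continuous_along assms(5) cont v(1)) auto
  then have "continuous_on {a..b} (\<lambda>t. g c (\<gamma> t) (v t) (v t))"
    by (rule continuous_on_eq) (use assms(6) in \<open>auto simp: chart_inv(1)[OF assms(5)] image_subset_iff\<close>)
  then have int: "(\<lambda>t. sqrt (g c (\<gamma> t) (v t) (v t))) integrable_on {a..b}"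
    by (intro integrable_continuous_real continuous_intros)
  \<comment> \<open>At \<open>a\<close> and \<open>b\<close> the derivative \<open>v\<close> is
    one-sided and may differ from the one in \<open>path_speed\<close>, which is taken within
    \<open>{0..1}\<close>. Two points do not affect integrability.\<close>
  have eq: "path_speed A g \<gamma> t = sqrt (g c (\<gamma> t) (v t) (v t))" if "t \<in> {a..b} - {a, b}" for t
    using that assms v(2)[of t] by (intro path_speed_in_chart) (auto simp: at_within_Icc_at)
  show ?thesis by (rule integrable_spike_finite[where S = "{a, b}" and T = "{a..b}", OF _ eq int]) simp_all
qed

text \<open>Integrability on a compact interval is a local property, so one chart around each point
  of the path suffices.\<close>

lemma path_speed_integrable:
  assumes "piecewise_C1_path X A \<gamma>"
  shows "path_speed A g \<gamma> integrable_on {0..1}"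
proof -
  obtain T where \<gamma>: "pathin X \<gamma>" and "finite T"
    and T: "\<And>a b. 0 \<le> a \<Longrightarrow> a < b \<Longrightarrow> b \<le> 1 \<Longrightarrow> {a<..<b} \<inter> T = {} \<Longrightarrow> C1_path_on A a b \<gamma>"
    using assms unfolding piecewise_C1_path_def by metis
  have "path_speed A g \<gamma> integrable_on cbox 0 1"
  proof (rule integrable_on_little_subintervals, rule ballI)
    fix x :: real assume "x \<in> cbox 0 1"
    then have x: "x \<in> {0..1}" by simp
    then have "\<gamma> x \<in> topspace X"
      using \<gamma> continuous_map_image_subset_topspace[of "top_of_set {0..1}" X \<gamma>]
      by (auto simp: pathin_def)
    then obtain c where c: "c \<in> A" "\<gamma> x \<in> fst c" using covers by auto
    obtain d where d: "d > 0" "\<And>s. s \<in> {0..1} \<Longrightarrow> \<bar>s - x\<bar> < d \<Longrightarrow> \<gamma> s \<in> fst c"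
      "\<And>s. s \<in> T \<Longrightarrow> s \<noteq> x \<Longrightarrow> d \<le> \<bar>s - x\<bar>"
      using piecewise_C1_path_local[OF \<gamma> \<open>finite T\<close> c(1) x c(2)] by blast
    \<comment> \<open>\<open>x\<close> may be a break point, but it is the only possible one within
      distance \<open>d\<close>. Intervals without \<open>x\<close> in their interior are therefore
      harmless, and an interval around \<open>x\<close> is cut at \<open>x\<close>.\<close>
    have part: "path_speed A g \<gamma> integrable_on {a..b}"
      if ab: "a \<le> b" "0 \<le> a" "b \<le> 1" "x - d < a" "b < x + d" "x \<notin> {a<..<b}" for a b
    proof (cases "a = b")
      case False
      have "{a<..<b} \<inter> T = {}"
      proof (rule ccontr)
        assume "{a<..<b} \<inter> T \<noteq> {}"
        then obtain s where s: "s \<in> T" "a < s" "s < b" by auto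
        then have "s \<noteq> x" using ab by auto
        then show False using d(3)[of s] s ab by auto
      qed
      then have "C1_path_on A a b \<gamma>" using ab False by (intro T) auto
      moreover have "\<gamma> ` {a..b} \<subseteq> fst c" using ab by (auto intro!: d(2))
      ultimately show ?thesis using path_speed_integrable_C1[OF \<gamma> ab(2,3) _ c(1)] by blast
    next
      case True
      then show ?thesis using integrable_on_refl[of "path_speed A g \<gamma>" b] by simp
    qed
    show "\<exists>d>0. \<forall>u v. x \<in> cbox u v \<and> cbox u v \<subseteq> ball x d \<and> cbox u v \<subseteq> cbox 0 1 \<longrightarrow>
        path_speed A g \<gamma> integrable_on cbox u v"
    proof (intro exI[of _ d] conjI allI impI d(1))
      fix u v assume "x \<in> cbox u v \<and> cbox u v \<subseteq> ball x d \<and> cbox u v \<subseteq> cbox 0 1"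
      then have *: "u \<le> x" "x \<le> v" "{u..v} \<subseteq> ball x d" "{u..v} \<subseteq> {0..1}" by auto
      then have "u \<in> {u..v}" "v \<in> {u..v}" by auto
      then have "u \<in> ball x d" "v \<in> ball x d" "u \<in> {0..1}" "v \<in> {0..1}" using *(3,4) by blast+
      then have "path_speed A g \<gamma> integrable_on {u..x}" "path_speed A g \<gamma> integrable_on {x..v}"
        using *(1,2) x d(1) by (auto intro!: part simp: dist_real_def)
      then show "path_speed A g \<gamma> integrable_on cbox u v"
        using Henstock_Kurzweil_Integration.integrable_combine[OF *(1,2)] by simp
    qed
  qed
  then show ?thesis by simp
qed

lemma path_length_nonneg:
  assumes "piecewise_C1_path X A \<gamma>"
  shows "path_length A g \<gamma> \<ge> 0"
  unfolding path_length_def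
  using assms path_speed_integrable path_speed_nonneg
  by (intro integral_nonneg) (auto simp: piecewise_C1_path_def)

lemma riemannian_dist_le:
  assumes "piecewise_C1_path X A \<gamma>" "\<gamma> 0 = x" "\<gamma> 1 = y"
  shows "riemannian_dist X A g x y \<le> path_length A g \<gamma>"
  unfolding riemannian_dist_def
  by (rule cInf_lower) (use assms path_length_nonneg in \<open>auto intro!: bdd_belowI[of _ 0]\<close>)

end


section \<open>Charts orthonormalised at a point\<close>

text \<open>\<open>L\<close> carries \<open>g c p\<close> to the inner product of \<open>'e\<close>.
  With this linear change of coordinates the distortion near \<open>p\<close> is close to 1 and not
  merely bounded.\<close>

locale framed_chart = riemannian_manifold X A g
  for X :: "'a topology" and A :: "('a, 'e::real_inner) chart set" and g +
  fixes c :: "('a, 'e) chart" and p :: 'a and L L' :: "'e \<Rightarrow> 'e"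
  assumes c: "c \<in> A" and p: "p \<in> fst c"
    and lin: "linear L" "linear L'"
    and L'L: "L' (L v) = v" and LL': "L (L' v) = v"
    and frame: "g c p v w = L v \<bullet> L w"
begin

definition coord :: "'a \<Rightarrow> 'e" where
  "coord q = L (snd c q - snd c p)"

definition unframe :: "'e \<Rightarrow> 'e" where
  "unframe y = snd c p + L' y"

definition param :: "'e \<Rightarrow> 'a" where
  "param y = inv_into (fst c) (snd c) (unframe y)"

definition dom :: "'e set" where
  "dom = {y. unframe y \<in> snd c ` fst c}"

text \<open>The metric pulled back along \<open>param\<close>. Tangent vectors pass through
  \<open>L'\<close> because it is the differential of \<open>unframe\<close>.\<close>

definition form :: "'e \<Rightarrow> 'e \<Rightarrow> 'e \<Rightarrow> real" where
  "form y v w = g c (param y) (L' v) (L' w)"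

lemma bounded_linear_L: "bounded_linear L" and bounded_linear_L': "bounded_linear L'"
  using bounded_linear_finite_dim[OF finite_dim] lin by blast+

lemma unframe_coord: "unframe (coord q) = snd c q"
  by (simp add: unframe_def coord_def L'L)

lemma continuous_on_unframe: "continuous_on S unframe"
  unfolding unframe_def
  by (intro continuous_intros bounded_linear.continuous_on[OF bounded_linear_L'])

lemma dom_open: "open dom"
  using open_vimage[OF chart_image_open[OF c] continuous_on_unframe]
  by (simp add: dom_def vimage_def)

lemma param_in: "y \<in> dom \<Longrightarrow> param y \<in> fst c"
  using chart_inv(3)[OF c] by (simp add: dom_def param_def)

lemma chart_param: "y \<in> dom \<Longrightarrow> snd c (param y) = unframe y"
  using chart_inv(2)[OF c] by (simp add: dom_def param_def)

lemma coord_param: "y \<in> dom \<Longrightarrow> coord (param y) = y"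
  by (simp add: coord_def chart_param) (simp add: unframe_def LL')

lemma coord_dom: "q \<in> fst c \<Longrightarrow> coord q \<in> dom"
  by (simp add: dom_def unframe_coord)

lemma param_coord: "q \<in> fst c \<Longrightarrow> param (coord q) = q"
  using chart_inv(1)[OF c] by (simp add: param_def unframe_coord)

lemma coord_p: "coord p = 0"
  using linear_0[OF lin(1)] by (simp add: coord_def)

lemma zero_dom: "0 \<in> dom" and param_0: "param 0 = p"
  using coord_dom[OF p] param_coord[OF p] by (simp_all add: coord_p)

lemma param_topspace: "y \<in> dom \<Longrightarrow> param y \<in> topspace X"
  using param_in chart_subset[OF c] by blast

lemma param_image: "S \<subseteq> dom \<Longrightarrow> param ` S = {q \<in> fst c. coord q \<in> S}"
  using param_in coord_param param_coord by force

lemma param_continuous: "continuous_map (top_of_set dom) X param"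
proof -
  have "continuous_map (top_of_set dom) (top_of_set (snd c ` fst c)) unframe"
    by (auto simp: continuous_map_in_subtopology continuous_on_unframe dom_def)
  from continuous_map_compose[OF this chart_inv_continuous[OF c]]
  show ?thesis by (simp add: o_def param_def[abs_def])
qed

lemma coord_continuous: "continuous_map (subtopology X (fst c)) euclidean coord"
proof -
  have "continuous_on UNIV (\<lambda>x. L (x - snd c p))"
    by (intro continuous_intros bounded_linear.continuous_on[OF bounded_linear_L])
  then have "continuous_map (subtopology X (fst c)) euclidean ((\<lambda>x. L (x - snd c p)) \<circ> snd c)"
    by (intro continuous_map_compose[OF chart_continuous[OF c]]) simp
  then show ?thesis by (simp add: o_def coord_def[abs_def])
qed

lemma param_openin:
  assumes "open S" "S \<subseteq> dom"
  shows "openin X (param ` S)"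
proof -
  have "openin (subtopology X (fst c)) {q \<in> topspace (subtopology X (fst c)). coord q \<in> S}"
    by (rule openin_continuous_map_preimage[OF coord_continuous]) (use assms in simp)
  moreover have "{q \<in> topspace (subtopology X (fst c)). coord q \<in> S} = param ` S"
    using param_image[OF assms(2)] chart_subset[OF c] by auto
  ultimately show ?thesis using chart_open[OF c] by (metis openin_trans_full)
qed

text \<open>Compact sets are closed in a Hausdorff space. \<open>path_length_exit\<close> relies on
  this to keep a path inside the chart up to and including its exit time.\<close>

lemma param_closedin:
  assumes "compact S" "S \<subseteq> dom"
  shows "closedin X (param ` S)"
proof (rule compactin_imp_closedin[OF Hausdorff image_compactin[OF _ param_continuous]])
  show "compactin (top_of_set dom) S"
    using assms by (simp add: compactin_subtopology)
qed

lemma form_bilinear: "y \<in> dom \<Longrightarrow> bilinear (form y)"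
  using bilinear[OF c param_in] linear_compose[OF lin(2)] unfolding bilinear_def form_def
  by (auto simp: o_def)

lemma form_0: "form 0 v w = v \<bullet> w"
  by (simp add: form_def param_0 frame LL')

lemma form_continuous: "continuous_on dom (\<lambda>y. form y v w)"
  unfolding form_def param_def
  by (rule continuous_on_compose2[OF metric_continuous[OF c] continuous_on_unframe])
    (auto simp: dom_def)

text \<open>The entrywise deviation \<open>h\<close> of \<open>form\<close> from the inner product
  is continuous and vanishes at 0, and it controls the deviation of the quadratic form relative to
  the squared norm.\<close>

lemma form_near_inner:
  assumes "0 < \<epsilon>" "\<epsilon> < 1"
  obtains r where "r > 0" "ball 0 r \<subseteq> dom"
    "\<And>y v. y \<in> ball 0 r \<Longrightarrow> (1 - \<epsilon>) * norm v \<le> sqrt (form y v v)"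
    "\<And>y v. y \<in> ball 0 r \<Longrightarrow> sqrt (form y v v) \<le> (1 + \<epsilon>) * norm v"
proof -
  obtain B :: "'e set" where B: "orthonormal_basis inner B"
    using orthonormal_basis_inner_exists finite_dim by blast
  define h where "h y = (\<Sum>a\<in>B. \<Sum>b\<in>B. \<bar>form y a b - a \<bullet> b\<bar>)" for y
  have "continuous_on dom h"
    unfolding h_def by (intro continuous_intros form_continuous)
  moreover have "h 0 = 0" by (simp add: h_def form_0)
  ultimately obtain d where d: "d > 0" "\<And>y. y \<in> dom \<Longrightarrow> dist y 0 < d \<Longrightarrow> dist (h y) 0 < \<epsilon>"
    using zero_dom assms(1) unfolding continuous_on_iff by metis
  obtain d' where d': "d' > 0" "ball 0 d' \<subseteq> dom"
    using dom_open zero_dom open_contains_ball by blast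
  define r where "r = min d d'"
  have r: "r > 0" "ball 0 r \<subseteq> dom" "\<And>y. y \<in> ball 0 r \<Longrightarrow> h y < \<epsilon>"
    using d d' by (auto simp: r_def) (force simp: dist_norm)
  have dev: "\<bar>form y v v - (norm v)\<^sup>2\<bar> \<le> \<epsilon> * (norm v)\<^sup>2" if y: "y \<in> ball 0 r" for y v :: 'e
  proof -
    have yd: "y \<in> dom" using y r(2) by blast
    have inner_bil: "bilinear (inner :: 'e \<Rightarrow> 'e \<Rightarrow> real)" by (rule dot.bilin)
    have "form y v v - (norm v)\<^sup>2 = (\<Sum>a\<in>B. \<Sum>b\<in>B. (v \<bullet> a) * (v \<bullet> b) * (form y a b - a \<bullet> b))"
      unfolding power2_norm_eq_inner bilinear_orthonormal_expansion[OF form_bilinear[OF yd] B, of v v]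
      by (subst bilinear_orthonormal_expansion[OF inner_bil B, of v v])
        (simp add: sum_subtractf right_diff_distrib)
    also have "\<bar>\<dots>\<bar> \<le> (\<Sum>a\<in>B. \<Sum>b\<in>B. (norm v)\<^sup>2 * \<bar>form y a b - a \<bullet> b\<bar>)"
    proof (intro order_trans[OF sum_abs] sum_mono)
      fix a b assume "a \<in> B" "b \<in> B"
      then have "\<bar>v \<bullet> a\<bar> * \<bar>v \<bullet> b\<bar> \<le> norm v * norm v"
        using norm_orthonormal_le[OF B] by (intro mult_mono) auto
      then show "\<bar>(v \<bullet> a) * (v \<bullet> b) * (form y a b - a \<bullet> b)\<bar> \<le> (norm v)\<^sup>2 * \<bar>form y a b - a \<bullet> b\<bar>"
        unfolding abs_mult by (intro mult_right_mono) (auto simp: power2_eq_square)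
    qed
    also have "\<dots> = (norm v)\<^sup>2 * h y" by (simp add: h_def sum_distrib_left)
    also have "\<dots> \<le> (norm v)\<^sup>2 * \<epsilon>" using r(3)[OF y] by (intro mult_left_mono) auto
    finally show ?thesis by (simp add: mult.commute)
  qed
  show thesis
  proof (rule that[OF r(1,2)])
    fix y v :: 'e assume y: "y \<in> ball 0 r"
    \<comment> \<open>\<open>dev\<close> gives the factors \<open>1 - \<epsilon>\<close> and
      \<open>1 + \<epsilon>\<close> for the squares; weakening them to their squares allows roots to
      be taken.\<close>
    have "(1 - \<epsilon>)\<^sup>2 \<le> 1 - \<epsilon>" "1 + \<epsilon> \<le> (1 + \<epsilon>)\<^sup>2"
      using assms by (auto simp: power2_eq_square algebra_simps mult_left_le)
    then have "(1 - \<epsilon>)\<^sup>2 * (norm v)\<^sup>2 \<le> (1 - \<epsilon>) * (norm v)\<^sup>2"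
      "(1 + \<epsilon>) * (norm v)\<^sup>2 \<le> (1 + \<epsilon>)\<^sup>2 * (norm v)\<^sup>2" by (intro mult_right_mono; simp)+
    then have "((1 - \<epsilon>) * norm v)\<^sup>2 \<le> form y v v" "form y v v \<le> ((1 + \<epsilon>) * norm v)\<^sup>2"
      unfolding power_mult_distrib using dev[OF y, of v] by (auto simp: abs_le_iff algebra_simps)
    then show "(1 - \<epsilon>) * norm v \<le> sqrt (form y v v)" "sqrt (form y v v) \<le> (1 + \<epsilon>) * norm v"
      using assms by (auto intro: real_le_rsqrt real_le_lsqrt)
  qed
qed

section \<open>Lower bounds for the length of a path\<close>

lemma coord_derivative:
  assumes "(snd c \<circ> \<gamma> has_vector_derivative w) F"
  shows "((\<lambda>t. coord (\<gamma> t)) has_vector_derivative L w) F"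
proof -
  have "((\<lambda>t. (snd c \<circ> \<gamma>) t - snd c p) has_vector_derivative w) F"
    using assms by (auto intro!: derivative_eq_intros simp: o_def)
  from bounded_linear.has_vector_derivative[OF bounded_linear_L this]
  show ?thesis by (simp add: coord_def)
qed

lemma path_speed_form:
  assumes "pathin X \<gamma>" "t \<in> {0<..<1}" "\<gamma> t \<in> fst c" "(snd c \<circ> \<gamma> has_vector_derivative w) (at t)"
  shows "path_speed A g \<gamma> t = sqrt (form (coord (\<gamma> t)) (L w) (L w))"
  using path_speed_in_chart[OF assms(1,2) c assms(3,4)] param_coord[OF assms(3)]
  by (simp add: form_def L'L)

text \<open>The Riemannian speed is at least \<open>k\<close> times the Euclidean speed in
  coordinates. Only the piece up to \<open>s\<close> is estimated; the rest has nonnegative length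
  and may leave the chart.\<close>

lemma path_length_lower:
  assumes \<gamma>: "piecewise_C1_path X A \<gamma>" and s: "0 \<le> s" "s \<le> 1"
    and stay: "\<And>t. t \<in> {0..s} \<Longrightarrow> \<gamma> t \<in> fst c \<and> coord (\<gamma> t) \<in> S"
    and S: "\<And>y v. y \<in> S \<Longrightarrow> k * norm v \<le> sqrt (form y v v)" and k: "k \<ge> 0"
  shows "k * norm (coord (\<gamma> s) - coord (\<gamma> 0)) \<le> path_length A g \<gamma>"
proof -
  obtain T where path: "pathin X \<gamma>" and fin: "finite T"
    and T: "\<And>a b. 0 \<le> a \<Longrightarrow> a < b \<Longrightarrow> b \<le> 1 \<Longrightarrow> {a<..<b} \<inter> T = {} \<Longrightarrow> C1_path_on A a b \<gamma>"
    using \<gamma> unfolding piecewise_C1_path_def by metis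
  have "\<exists>v. (snd c \<circ> \<gamma> has_vector_derivative v) (at t)" if t: "t \<in> {0<..<s} - T" for t
  proof -
    have "t \<in> {0<..<1} - T" "\<gamma> t \<in> fst c" using t s stay by auto
    then show ?thesis using piecewise_C1_path_derivative[OF path fin T c] by blast
  qed
  then obtain u where u: "\<And>t. t \<in> {0<..<s} - T \<Longrightarrow> (snd c \<circ> \<gamma> has_vector_derivative u t) (at t)"
    by metis
  \<comment> \<open>Pairing with \<open>w\<close> reduces the estimate to the fundamental theorem of calculus for a real function.\<close>
  define w where "w = coord (\<gamma> s) - coord (\<gamma> 0)"
  \<comment> \<open>The value 0 at break points and endpoints, where no derivative is available,
    leaves the integral unchanged and makes the bound by the nonnegative speed hold there
    too.\<close>
  define f' where "f' t = (if t \<in> {0<..<s} - T then L (u t) \<bullet> w else 0)" for t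
  have "continuous_map (top_of_set {0..s}) (subtopology X (fst c)) \<gamma>"
  proof -
    have "top_of_set {0..s} = subtopology (top_of_set {0..1}) {0..s}"
      using s by (simp add: subtopology_subtopology Int_absorb1)
    then show ?thesis
      using path stay continuous_map_from_subtopology[of "top_of_set {0..1}" X \<gamma> "{0..s}"]
      by (auto simp: pathin_def continuous_map_in_subtopology)
  qed
  from continuous_map_compose[OF this coord_continuous]
  have "continuous_on {0..s} (\<lambda>t. coord (\<gamma> t))" by (simp add: o_def)
  then have "continuous_on {0..s} (\<lambda>t. coord (\<gamma> t) \<bullet> w)" by (intro continuous_intros)
  moreover have "((\<lambda>t. coord (\<gamma> t) \<bullet> w) has_vector_derivative f' t) (at t)"
    if "t \<in> {0<..<s} - T" for t
    using bounded_linear.has_vector_derivative[OF bounded_linear_inner_left coord_derivative[OF u[OF that]]] that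
    by (simp add: f'_def)
  ultimately have "(f' has_integral (coord (\<gamma> s) \<bullet> w - coord (\<gamma> 0) \<bullet> w)) {0..s}"
    using s fin by (intro fundamental_theorem_of_calculus_interior_strong) auto
  then have "((\<lambda>t. k * f' t) has_integral k * (w \<bullet> w)) {0..s}"
    by (intro has_integral_mult_right) (simp add: w_def inner_diff_left)
  moreover have int: "path_speed A g \<gamma> integrable_on {0..1}"
    using path_speed_integrable[OF \<gamma>] .
  then have int_s: "path_speed A g \<gamma> integrable_on {0..s}"
    using s by (intro integrable_on_subinterval[OF int]) auto
  then have "((\<lambda>t. norm w * path_speed A g \<gamma> t) has_integral norm w * integral {0..s} (path_speed A g \<gamma>)) {0..s}"
    by (intro has_integral_mult_right integrable_integral)
  moreover have "k * f' t \<le> norm w * path_speed A g \<gamma> t" if t: "t \<in> {0..s}" for t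
  proof (cases "t \<in> {0<..<s} - T")
    case True
    have "path_speed A g \<gamma> t = sqrt (form (coord (\<gamma> t)) (L (u t)) (L (u t)))"
      using path_speed_form[OF path _ _ u[OF True]] True stay[OF t] s by auto
    then have *: "k * norm (L (u t)) \<le> path_speed A g \<gamma> t" using S stay[OF t] by simp
    have "k * f' t \<le> k * (norm (L (u t)) * norm w)"
      using True k norm_cauchy_schwarz[of "L (u t)" w] by (auto simp: f'_def intro: mult_left_mono)
    also have "\<dots> = norm w * (k * norm (L (u t)))" by simp
    also have "\<dots> \<le> norm w * path_speed A g \<gamma> t" by (intro mult_left_mono * norm_ge_zero)
    finally show ?thesis .
  next
    case False
    have "path_speed A g \<gamma> t \<ge> 0" using path_speed_nonneg[OF path, of t] t s by auto
    moreover have "f' t = 0" unfolding f'_def using False by (rule if_not_P)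
    ultimately show ?thesis by simp
  qed
  ultimately have "k * (w \<bullet> w) \<le> norm w * integral {0..s} (path_speed A g \<gamma>)"
    by (rule has_integral_le)
  also have "\<dots> \<le> norm w * path_length A g \<gamma>"
    unfolding path_length_def using s path_speed_nonneg[OF path]
    by (intro mult_left_mono integral_subset_le int int_s) auto
  finally have "norm w * (k * norm w) \<le> norm w * path_length A g \<gamma>"
    by (simp add: power2_norm_eq_inner[symmetric] power2_eq_square mult.left_commute)
  then show ?thesis
    using path_length_nonneg[OF \<gamma>] by (cases "w = 0") (auto simp: w_def[symmetric])
qed

text \<open>At the time of first exit from the open ball the coordinates have moved by at least
  \<open>\<rho> - norm x\<close>, and up to then the path lies in the closed ball, where
  \<open>path_length_lower\<close> applies.\<close>

lemma path_length_exit: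
  assumes \<gamma>: "piecewise_C1_path X A \<gamma>" and \<rho>: "cball 0 \<rho> \<subseteq> dom"
    and S: "\<And>y v. y \<in> cball 0 \<rho> \<Longrightarrow> k * norm v \<le> sqrt (form y v v)" and k: "k \<ge> 0"
    and x: "\<gamma> 0 = param x" "norm x < \<rho>"
    and exit: "t \<in> {0..1}" "\<gamma> t \<notin> param ` ball 0 \<rho>"
  shows "k * (\<rho> - norm x) \<le> path_length A g \<gamma>"
proof -
  have path: "pathin X \<gamma>" using \<gamma> by (simp add: piecewise_C1_path_def)
  have ball: "ball 0 \<rho> \<subseteq> dom" using \<rho> by auto
  have \<gamma>X: "\<gamma> t \<in> topspace X" if "t \<in> {0..1}" for t
    using path that continuous_map_image_subset_topspace[of "top_of_set {0..1}" X \<gamma>]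
    by (auto simp: pathin_def)
  \<comment> \<open>The times spent outside. \<open>E\<close> is closed because \<open>param\<close>
    maps the open ball to an open set, so its infimum is attained.\<close>
  define E where "E = {t \<in> {0..1}. \<gamma> t \<notin> param ` ball 0 \<rho>}"
  have "openin (top_of_set {0..1}) {t \<in> topspace (top_of_set {0..1}). \<gamma> t \<in> param ` ball 0 \<rho>}"
    using path param_openin[OF open_ball ball] unfolding pathin_def
    by (rule openin_continuous_map_preimage)
  then have "closedin (top_of_set {0..1}) ({0..1} - {t \<in> {0..1}. \<gamma> t \<in> param ` ball 0 \<rho>})"
    by (metis closedin_diff closedin_topspace topspace_euclidean_subtopology)
  moreover have "{0..1} - {t \<in> {0..1}. \<gamma> t \<in> param ` ball 0 \<rho>} = E" by (auto simp: E_def)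
  ultimately have "closed E" using closedin_closed_trans[of "{0..1}" E] by auto
  moreover have E: "t \<in> E" "bdd_below E" using exit by (auto simp: E_def intro: bdd_belowI[of _ 0])
  ultimately have s: "Inf E \<in> E" by (intro closed_contains_Inf) auto
  define s where "s = Inf E"
  have before: "\<gamma> t \<in> param ` ball 0 \<rho>" if "0 \<le> t" "t < s" for t
  proof (rule ccontr)
    assume "\<gamma> t \<notin> param ` ball 0 \<rho>"
    then have "t \<in> E" using that s by (auto simp: E_def s_def)
    then show False using cInf_lower[OF _ E(2)] that by (fastforce simp: s_def)
  qed
  have "s \<in> E" "0 \<notin> E" using s x by (auto simp: s_def E_def)
  then have s01: "0 < s" "s \<le> 1" "\<gamma> s \<notin> param ` ball 0 \<rho>"
    by (force simp: E_def order_less_le)+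
  \<comment> \<open>The image of the closed ball is closed, so the limit point
    \<open>\<gamma> s\<close> still lies in it, and \<open>coord\<close> is meaningful
    there.\<close>
  have "closedin (top_of_set {0..1}) {t \<in> topspace (top_of_set {0..1}). \<gamma> t \<in> param ` cball 0 \<rho>}"
    using path param_closedin[OF compact_cball_finite_dim[OF finite_dim] \<rho>] unfolding pathin_def
    by (rule closedin_continuous_map_preimage)
  then have "closed {t \<in> {0..1}. \<gamma> t \<in> param ` cball 0 \<rho>}"
    using closedin_closed_trans[of "{0..1}"] by auto
  moreover have "{0..<s} \<subseteq> {t \<in> {0..1}. \<gamma> t \<in> param ` cball 0 \<rho>}"
    using before s01 ball_subset_cball by fastforce
  ultimately have "closure {0..<s} \<subseteq> {t \<in> {0..1}. \<gamma> t \<in> param ` cball 0 \<rho>}"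
    by (rule closure_minimal[rotated])
  then have stay: "\<gamma> t \<in> param ` cball 0 \<rho>" if "t \<in> {0..s}" for t using s01 that by auto
  have "coord (\<gamma> s) \<notin> ball 0 \<rho>" "\<gamma> s \<in> fst c"
    using s01(1,3) stay[of s] unfolding param_image[OF ball] param_image[OF \<rho>] by auto
  moreover have "coord (\<gamma> 0) = x" using x ball by (simp add: coord_param subset_iff)
  ultimately have "\<rho> - norm x \<le> norm (coord (\<gamma> s) - coord (\<gamma> 0))"
    using norm_triangle_ineq2[of "coord (\<gamma> s)" x] by (simp add: not_less)
  then have "k * (\<rho> - norm x) \<le> k * norm (coord (\<gamma> s) - coord (\<gamma> 0))"
    using k by (rule mult_left_mono)
  also have "\<dots> \<le> path_length A g \<gamma>"
    using stay s01 S k unfolding param_image[OF \<rho>]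
    by (intro path_length_lower[OF \<gamma>, where S = "cball 0 \<rho>"]) auto
  finally show ?thesis .
qed

section \<open>Straight segments in coordinates and upper bounds\<close>

lemma
  fixes x u :: 'e
  defines "\<gamma> \<equiv> \<lambda>t. param (x + t *\<^sub>R u)"
  assumes dom: "\<And>t. t \<in> {0..1} \<Longrightarrow> x + t *\<^sub>R u \<in> dom"
  shows segment_piecewise_C1_path: "piecewise_C1_path X A \<gamma>"
    and segment_path_speed: "t \<in> {0<..<1} \<Longrightarrow> path_speed A g \<gamma> t = sqrt (form (x + t *\<^sub>R u) u u)"
proof -
  define z where "z t = unframe (x + t *\<^sub>R u)" for t
  have zd: "(z has_vector_derivative L' u) F" for F
  proof -
    have "((\<lambda>t. t *\<^sub>R u) has_vector_derivative 1 *\<^sub>R u) F"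
      by (rule bounded_linear.has_vector_derivative[OF bounded_linear_scaleR_left has_vector_derivative_id])
    then have "((\<lambda>t. x + t *\<^sub>R u) has_vector_derivative u) F"
      by (auto intro!: derivative_eq_intros)
    from bounded_linear.has_vector_derivative[OF bounded_linear_L' this]
    show ?thesis unfolding z_def unframe_def by (auto intro!: derivative_eq_intros)
  qed
  have zcont: "continuous_on J z" for J
    unfolding z_def by (intro continuous_on_compose2[OF continuous_on_unframe[of UNIV]] continuous_intros) auto
  have \<gamma>c: "\<gamma> t \<in> fst c" "snd c (\<gamma> t) = z t" if "t \<in> {0..1}" for t
    using param_in chart_param dom[OF that] by (auto simp: \<gamma>_def z_def)
  \<comment> \<open>The condition concerns every chart of the atlas; in \<open>c'\<close> the
    constant velocity \<open>L' u\<close> is transported by the derivative of the transition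
    map.\<close>
  have C1: "C1_path_on A a b \<gamma>" if ab: "0 \<le> a" "b \<le> 1" for a b
    unfolding C1_path_on_def Let_def
  proof
    fix c' assume c': "c' \<in> A"
    define J where "J = {t \<in> {a..b}. \<gamma> t \<in> fst c'}"
    have zJ: "z t \<in> snd c ` (fst c \<inter> fst c')" if "t \<in> J" for t
      using that ab \<gamma>c[of t] by (auto simp: J_def intro!: rev_image_eqI[of "\<gamma> t"])
    define v where "v t = frechet_derivative (transition c c') (at (z t)) (L' u)" for t
    have "continuous_on J v"
      unfolding v_def
      by (rule continuous_on_compose2[OF transition_derivative(2)[OF c c'] zcont]) (use zJ in auto)
    moreover have "(snd c' \<circ> \<gamma> has_vector_derivative v t) (at t within J)" if "t \<in> J" for t
    proof -
      have "snd c' \<circ> \<gamma> = transition c c' \<circ> z"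
        by (auto simp: transition_def \<gamma>_def param_def z_def)
      moreover have "(transition c c' \<circ> z has_vector_derivative v t) (at t within J)"
        unfolding v_def
        by (rule vector_derivative_diff_chain_within[OF zd has_derivative_at_withinI])
          (rule transition_derivative(1)[OF c c' zJ[OF that]])
      ultimately show ?thesis by simp
    qed
    ultimately show "\<exists>v. continuous_on {t \<in> {a..b}. \<gamma> t \<in> fst c'} v \<and>
        (\<forall>t\<in>{t \<in> {a..b}. \<gamma> t \<in> fst c'}. (snd c' \<circ> \<gamma> has_vector_derivative v t)
           (at t within {t \<in> {a..b}. \<gamma> t \<in> fst c'}))"
      unfolding J_def[symmetric] by blast
  qed
  have "continuous_map (top_of_set {0..1}) (top_of_set dom) (\<lambda>t. x + t *\<^sub>R u)"
    using dom by (auto simp: continuous_map_in_subtopology intro!: continuous_intros)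
  from continuous_map_compose[OF this param_continuous]
  have path: "pathin X \<gamma>" by (simp add: pathin_def o_def \<gamma>_def)
  then show "piecewise_C1_path X A \<gamma>"
    using C1 unfolding piecewise_C1_path_def by (intro conjI exI[of _ "{}"]) auto
  assume t: "t \<in> {0<..<1}"
  have "(snd c \<circ> \<gamma> has_vector_derivative L' u) (at t)"
    by (rule has_vector_derivative_transform_within_open[OF zd, of "{0<..<1}"]) (use t \<gamma>c in auto)
  from path_speed_form[OF path t _ this] \<gamma>c[of t] t dom[of t]
  show "path_speed A g \<gamma> t = sqrt (form (x + t *\<^sub>R u) u u)"
    by (simp add: LL' \<gamma>_def coord_param)
qed

lemma segment_in_ball:
  assumes "x \<in> ball 0 r" "y \<in> ball 0 r" "t \<in> {0..1}"
  shows "x + t *\<^sub>R (y - x) \<in> ball (0::'e) r"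
proof -
  have "(1 - t) *\<^sub>R x + t *\<^sub>R y \<in> ball 0 r"
    using convexD_alt[OF convex_ball assms(1,2), of t] assms(3) by auto
  then show ?thesis by (simp add: algebra_simps)
qed

lemma riemannian_dist_param_le:
  assumes r: "ball 0 r \<subseteq> dom" and xy: "x \<in> ball 0 r" "y \<in> ball 0 r"
    and k: "\<And>z v. z \<in> ball 0 r \<Longrightarrow> sqrt (form z v v) \<le> k * norm v"
  shows "riemannian_dist X A g (param x) (param y) \<le> k * dist x y"
proof -
  have seg: "x + t *\<^sub>R (y - x) \<in> ball 0 r" if "t \<in> {0..1}" for t
    using segment_in_ball[OF xy that] .
  then have dom: "x + t *\<^sub>R (y - x) \<in> dom" if "t \<in> {0..1}" for t using r that by blast
  define \<gamma> where "\<gamma> t = param (x + t *\<^sub>R (y - x))" for t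
  have pw: "piecewise_C1_path X A \<gamma>"
    unfolding \<gamma>_def using segment_piecewise_C1_path[OF dom] .
  have "riemannian_dist X A g (param x) (param y) \<le> path_length A g \<gamma>"
    by (rule riemannian_dist_le[OF pw]) (auto simp: \<gamma>_def)
  also have "path_length A g \<gamma> \<le> k * dist x y"
    unfolding path_length_def
  proof (rule has_integral_le)
    show "(path_speed A g \<gamma> has_integral integral {0..1} (path_speed A g \<gamma>)) {0..1}"
      using path_speed_integrable[OF pw] by (rule integrable_integral)
    \<comment> \<open>The formula for the speed holds at interior times only. Letting the majorant
      equal the speed at 0 and 1 makes the comparison trivial there without changing the
      integral.\<close>
    define M where "M t = (if t \<in> {0, 1} then path_speed A g \<gamma> t else k * dist x y)" for t
    show "(M has_integral k * dist x y) {0..1}"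
      using has_integral_spike_finite[of "{0, 1}" "{0..1}" M "\<lambda>_. k * dist x y"]
        has_integral_const_real[of "k * dist x y" 0 1] by (auto simp: M_def)
    show "path_speed A g \<gamma> t \<le> M t" if "t \<in> {0..1}" for t
    proof (cases "t \<in> {0, 1}")
      case False
      then have t: "t \<in> {0<..<1}" using that by auto
      have "path_speed A g \<gamma> t = sqrt (form (x + t *\<^sub>R (y - x)) (y - x) (y - x))"
        unfolding \<gamma>_def using segment_path_speed[OF dom t] .
      also have "\<dots> \<le> k * norm (y - x)" using k seg that by blast
      finally show ?thesis using False by (simp add: M_def dist_norm norm_minus_commute)
    qed (simp add: M_def)
  qed
  finally show ?thesis .
qed

end

section \<open>Connecting paths and the local comparison of distances\<close>

context riemannian_manifold
begin

lemma framed_chart_exists: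
  assumes "c \<in> A" "p \<in> fst c"
  obtains L L' where "framed_chart X A g c p L L'"
proof -
  have form: "inner_form (g c p)"
    using bilinear symmetric positive assms by unfold_locales auto
  obtain L L' :: "'e \<Rightarrow> 'e" where L: "linear L" "linear L'" "\<And>v. L' (L v) = v" "\<And>v. L (L' v) = v"
    "\<And>v w. g c p v w = L v \<bullet> L w"
    using inner_form_linear_isometry[OF form finite_dim] by blast
  have "framed_chart_axioms A g c p L L'"
    using assms L by (simp add: framed_chart_axioms_def)
  then show thesis
    by (rule that[OF framed_chart.intro[OF riemannian_manifold_axioms]])
qed

lemma piecewise_C1_path_exists_local:
  assumes "q \<in> topspace X"
  obtains V where "openin X V" "q \<in> V"
    "\<And>x y. x \<in> V \<Longrightarrow> y \<in> V \<Longrightarrow> \<exists>\<gamma>. piecewise_C1_path X A \<gamma> \<and> \<gamma> 0 = x \<and> \<gamma> 1 = y"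
proof -
  obtain c where c: "c \<in> A" "q \<in> fst c" using assms covers by auto
  obtain L L' where "framed_chart X A g c q L L'" using framed_chart_exists[OF c] .
  then interpret framed_chart X A g c q L L' .
  obtain r where r: "r > 0" "ball 0 r \<subseteq> dom" using dom_open zero_dom open_contains_ball by blast
  show thesis
  proof (rule that)
    show "openin X (param ` ball 0 r)" using r by (intro param_openin) auto
    show "q \<in> param ` ball 0 r" using param_0 r(1) by (auto intro!: rev_image_eqI[of 0])
    fix x y assume "x \<in> param ` ball 0 r" "y \<in> param ` ball 0 r"
    then obtain a b where ab: "a \<in> ball 0 r" "b \<in> ball 0 r" "x = param a" "y = param b" by blast
    have "a + t *\<^sub>R (b - a) \<in> dom" if "t \<in> {0..1}" for t
      using segment_in_ball[OF ab(1,2) that] r(2) by blast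
    from segment_piecewise_C1_path[OF this]
    show "\<exists>\<gamma>. piecewise_C1_path X A \<gamma> \<and> \<gamma> 0 = x \<and> \<gamma> 1 = y"
      by (intro exI[of _ "\<lambda>t. param (a + t *\<^sub>R (b - a))"]) (simp add: ab)
  qed
qed

text \<open>The set reachable from \<open>x\<close> and its complement are both open. Since
  \<open>local\<close> joins any two points of \<open>V\<close> in either order, it takes the place
  of path reversal in the argument for the complement.\<close>

lemma piecewise_C1_path_exists:
  assumes "connected_space X" "x \<in> topspace X" "y \<in> topspace X"
  shows "\<exists>\<gamma>. piecewise_C1_path X A \<gamma> \<and> \<gamma> 0 = x \<and> \<gamma> 1 = y"
proof -
  define reach where "reach a b \<longleftrightarrow> (\<exists>\<gamma>. piecewise_C1_path X A \<gamma> \<and> \<gamma> 0 = a \<and> \<gamma> 1 = b)" for a b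
  have trans: "reach a b'" if ab: "reach a b" "reach b b'" for a b b'
  proof -
    obtain \<gamma>1 \<gamma>2 where "piecewise_C1_path X A \<gamma>1" "\<gamma>1 0 = a" "\<gamma>1 1 = b"
      "piecewise_C1_path X A \<gamma>2" "\<gamma>2 0 = b" "\<gamma>2 1 = b'"
      using ab unfolding reach_def by blast
    then show ?thesis
      unfolding reach_def using piecewise_C1_path_join[of X A \<gamma>1 \<gamma>2]
      by (intro exI[of _ "\<lambda>t. if t \<le> 1/2 then \<gamma>1 (2 * t) else \<gamma>2 (2 * t - 1)"]) auto
  qed
  have local: "\<exists>V. openin X V \<and> q \<in> V \<and> (\<forall>a\<in>V. \<forall>b\<in>V. reach a b)" if "q \<in> topspace X" for q
    using piecewise_C1_path_exists_local[OF that] unfolding reach_def by metis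
  define R where "R = {y \<in> topspace X. reach x y}"
  have "openin X R"
  proof (subst openin_subopen, rule ballI)
    fix q assume q: "q \<in> R"
    then obtain V where V: "openin X V" "q \<in> V" "\<And>a b. a \<in> V \<Longrightarrow> b \<in> V \<Longrightarrow> reach a b"
      using local[of q] by (auto simp: R_def)
    have "V \<subseteq> R"
      using V(2,3) openin_subset[OF V(1)] q trans unfolding R_def by blast
    then show "\<exists>V. openin X V \<and> q \<in> V \<and> V \<subseteq> R" using V by blast
  qed
  moreover have "openin X (topspace X - R)"
  proof (subst openin_subopen, rule ballI)
    fix q assume q: "q \<in> topspace X - R"
    then obtain V where V: "openin X V" "q \<in> V" "\<And>a b. a \<in> V \<Longrightarrow> b \<in> V \<Longrightarrow> reach a b"
      using local[of q] by auto
    have "V \<subseteq> topspace X - R"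
      using V(2,3) openin_subset[OF V(1)] q trans unfolding R_def by blast
    then show "\<exists>V. openin X V \<and> q \<in> V \<and> V \<subseteq> topspace X - R" using V by blast
  qed
  moreover have "R \<subseteq> topspace X" by (auto simp: R_def)
  moreover have "x \<in> R" using local[OF assms(2)] assms(2) by (auto simp: R_def)
  ultimately have "R = topspace X"
    using assms(1) unfolding connected_space_clopen_in closedin_def by blast
  then show ?thesis using assms(3) by (auto simp: R_def reach_def)
qed

text \<open>Connectedness ensures that the infimum is over a nonempty set.\<close>

lemma riemannian_dist_ge:
  assumes "connected_space X" "x \<in> topspace X" "y \<in> topspace X"
    and "\<And>\<gamma>. piecewise_C1_path X A \<gamma> \<Longrightarrow> \<gamma> 0 = x \<Longrightarrow> \<gamma> 1 = y \<Longrightarrow> K \<le> path_length A g \<gamma>"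
  shows "K \<le> riemannian_dist X A g x y"
  unfolding riemannian_dist_def
  using piecewise_C1_path_exists[OF assms(1-3)] assms(4) by (intro cInf_greatest) auto

end

text \<open>Segments give the upper estimate. For the lower one, a path either stays in the ball of
  radius \<rho> or pays for leaving it. The last clause is the exit estimate from the centre with
  radius \<open>r\<close>.\<close>

lemma (in framed_chart) param_almost_isometric:
  assumes conn: "connected_space X" and \<epsilon>: "0 < \<epsilon>" "\<epsilon> < 1"
  shows "\<exists>r>0. (\<forall>x\<in>ball 0 r. param x \<in> topspace X \<and> coord (param x) = x) \<and>
    (\<forall>x\<in>ball 0 r. \<forall>y\<in>ball 0 r.
      (1 - \<epsilon>) * dist x y \<le> riemannian_dist X A g (param x) (param y) \<and>
      riemannian_dist X A g (param x) (param y) \<le> (1 + \<epsilon>) * dist x y) \<and>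
    (\<forall>q\<in>topspace X. riemannian_dist X A g p q < (1 - \<epsilon>) * r \<longrightarrow> q \<in> param ` ball 0 r)"
proof -
  obtain R where R: "R > 0" "ball 0 R \<subseteq> dom"
    and lower: "\<And>y v. y \<in> ball 0 R \<Longrightarrow> (1 - \<epsilon>) * norm v \<le> sqrt (form y v v)"
    and upper: "\<And>y v. y \<in> ball 0 R \<Longrightarrow> sqrt (form y v v) \<le> (1 + \<epsilon>) * norm v"
    using form_near_inner[OF \<epsilon>] by blast
  have sub: "cball 0 \<rho> \<subseteq> dom" "\<And>y v. y \<in> cball 0 \<rho> \<Longrightarrow> (1 - \<epsilon>) * norm v \<le> sqrt (form y v v)"
    if "\<rho> < R" for \<rho>
    using that R(2) lower by (auto simp: subset_iff)
  have k: "1 - \<epsilon> \<ge> 0" using \<epsilon> by simp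
  \<comment> \<open>\<open>\<rho> < R\<close> places the closed ball of radius \<rho> where the
    estimates for \<open>form\<close> hold. Since \<open>\<rho> = 3 * r\<close>, leaving it from
    \<open>x\<close> costs at least \<open>(1 - \<epsilon>) * (2 * r)\<close>, whereas points of the
    ball of radius \<open>r\<close> are less than \<open>2 * r\<close> apart.\<close>
  define \<rho> where "\<rho> = R / 2"
  define r where "r = \<rho> / 3"
  have r: "0 < r" "r < R" "\<rho> < R" "\<rho> = 3 * r" using R by (auto simp: r_def \<rho>_def)
  have ball: "x \<in> ball 0 R" "x \<in> dom" if "x \<in> ball 0 r" for x using that r R by auto
  have "(1 - \<epsilon>) * dist x y \<le> riemannian_dist X A g (param x) (param y)"
    if xy: "x \<in> ball 0 r" "y \<in> ball 0 r" for x y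
  proof (rule riemannian_dist_ge[OF conn param_topspace param_topspace])
    fix \<gamma> assume \<gamma>: "piecewise_C1_path X A \<gamma>" "\<gamma> 0 = param x" "\<gamma> 1 = param y"
    show "(1 - \<epsilon>) * dist x y \<le> path_length A g \<gamma>"
    proof (cases "\<forall>t\<in>{0..1}. \<gamma> t \<in> param ` ball 0 \<rho>")
      case True
      have "ball 0 \<rho> \<subseteq> dom" using sub(1)[OF r(3)] by auto
      then have stay: "\<gamma> t \<in> fst c \<and> coord (\<gamma> t) \<in> ball 0 \<rho>" if "t \<in> {0..1}" for t
        using True that by (auto simp: param_image)
      have "(1 - \<epsilon>) * norm (coord (\<gamma> 1) - coord (\<gamma> 0)) \<le> path_length A g \<gamma>"
        using stay sub(2)[OF r(3)] k by (intro path_length_lower[OF \<gamma>(1), where S = "ball 0 \<rho>"]) auto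
      then show ?thesis
        using \<gamma>(2,3) coord_param ball xy by (simp add: dist_norm norm_minus_commute)
    next
      case False
      then obtain t where t: "t \<in> {0..1}" "\<gamma> t \<notin> param ` ball 0 \<rho>" by blast
      have "norm x < \<rho>" "dist x y \<le> \<rho> - norm x"
        using xy r norm_triangle_ineq4[of x y] by (auto simp: dist_norm)
      then have "(1 - \<epsilon>) * dist x y \<le> (1 - \<epsilon>) * (\<rho> - norm x)"
        using k by (intro mult_left_mono) auto
      also have "\<dots> \<le> path_length A g \<gamma>"
        by (rule path_length_exit[OF \<gamma>(1) sub(1)[OF r(3)] sub(2)[OF r(3)] k \<gamma>(2) \<open>norm x < \<rho>\<close> t])
      finally show ?thesis .
    qed
  qed (use ball xy in auto)
  moreover have "riemannian_dist X A g (param x) (param y) \<le> (1 + \<epsilon>) * dist x y"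
    if "x \<in> ball 0 r" "y \<in> ball 0 r" for x y
    using riemannian_dist_param_le[OF R(2) ball(1)[OF that(1)] ball(1)[OF that(2)] upper] .
  moreover have "q \<in> param ` ball 0 r"
    if q: "q \<in> topspace X" "riemannian_dist X A g p q < (1 - \<epsilon>) * r" for q
  proof (rule ccontr)
    assume out: "q \<notin> param ` ball 0 r"
    have "(1 - \<epsilon>) * (r - norm (0 :: 'e)) \<le> riemannian_dist X A g p q"
    proof (rule riemannian_dist_ge[OF conn _ q(1)])
      fix \<gamma> assume \<gamma>: "piecewise_C1_path X A \<gamma>" "\<gamma> 0 = p" "\<gamma> 1 = q"
      show "(1 - \<epsilon>) * (r - norm (0 :: 'e)) \<le> path_length A g \<gamma>"
        by (rule path_length_exit[OF \<gamma>(1) sub(1)[OF r(2)] sub(2)[OF r(2)] k, where t = 1])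
          (use \<gamma> r out in \<open>auto simp: param_0\<close>)
    qed (use param_topspace[OF zero_dom] param_0 in simp)
    then show False using q(2) by simp
  qed
  ultimately show ?thesis
    using r(1) ball(2) param_topspace coord_param by (intro exI[of _ r]) blast
qed

lemma isometric_trans:
  assumes "isometric M d N d'" "isometric N d' P d''"
  shows "isometric M d P d''"
proof -
  obtain f h where f: "isometry_onto M d N d' f" and h: "isometry_onto N d' P d'' h"
    using assms by (auto simp: isometric_def)
  have "bij_betw (h \<circ> f) M P"
    using f h by (auto simp: isometry_onto_def intro: bij_betw_trans)
  moreover have "f x \<in> N" if "x \<in> M" for x using f that by (auto simp: isometry_onto_def bij_betw_apply)
  ultimately have "isometry_onto M d P d'' (h \<circ> f)"
    using f h by (simp add: isometry_onto_def)
  then show ?thesis unfolding isometric_def by blast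
qed

theorem proposition1:
  fixes X :: "'a topology"
    and A :: "('a, 'e::real_inner) chart set"
    and g :: "('a, 'e) chart \<Rightarrow> 'a \<Rightarrow> 'e \<Rightarrow> 'e \<Rightarrow> real"
  assumes "riemannian_manifold X A g"
    and "connected_space X"
    and "homogeneous (topspace X) (riemannian_dist X A g)"
    and "admits_dilations (topspace X) (riemannian_dist X A g)"
  shows "\<exists>n. isometric (topspace X) (riemannian_dist X A g)
                       (topspace (Euclidean_space n)) (euclidean_dist n)"
proof -
  interpret riemannian_manifold X A g by fact
  \<comment> \<open>The centre of a dilation of factor 1 is a point of the manifold, which excludes
    the empty one.\<close>
  obtain p where pX: "p \<in> topspace X"
    using assms(4) unfolding admits_dilations_def is_dilation_def by (meson zero_less_one)
  then obtain c where c: "c \<in> A" "p \<in> fst c" using covers by auto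
  obtain L L' where "framed_chart X A g c p L L'" using framed_chart_exists[OF c] .
  then interpret framed_chart X A g c p L L' .
  have "isometric (topspace X) (riemannian_dist X A g) (UNIV :: 'e set) dist"
    using param_almost_isometric[OF assms(2)]
    by (rule homogeneous_dilation_isometric[where p = p and \<Psi> = param,
          OF finite_dim assms(3,4) pX param_0])
  then show ?thesis
    using isometric_Euclidean_space[OF finite_dim] isometric_trans by blast
qed

end
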